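(* Let $\widetilde{\mathcal Q}$ be an extended quiver with even vertices $x_1,\ldots,x_n$ and odd vertices $\xi_1,\ldots,\xi_m$. Then every element $x_k', x_k'',\ldots$ obtained recursively from the initial variables by any finite sequence of consecutive mutations $\widetilde\mu_{k_1},\widetilde\mu_{k_2},\ldots$ at even vertices (each mutation applied to the current extended quiver and current variables, using the exchange relation below) is a Laurent polynomial in the initial coordinates, i.e. it lies in $\mathbb{C}[x_1^{\pm1},\ldots,x_n^{\pm1},\xi_1,\ldots,\xi_m]$ (denominators being monomials in $x_1,\ldots,x_n$).
   Context: Grassmann variables $\xi_1,\ldots,\xi_m$ are odd: they anticommute pairwise ($\xi_i\xi_j=-\xi_j\xi_i$, in particular $\xi_i^2=0$) and commute with the even variables $x_1,\ldots,x_n$; all computations take place in the supercommutative algebra obtained by adjoining $\xi_1,\ldots,\xi_m$ to the field of rational functions $\mathbb{C}(x_1,\ldots,x_n)$. Extended quiver: $\widetilde{\mathcal Q}$ consists of (A) an ordinary quiver $\mathcal Q$ (finite, with no loops and no oriented 2-cycles, arrows counted with multiplicity) whose vertices are labeled by the even variables $x_1,\ldots,x_n$; (B) $m$ additional "odd" vertices labeled $\xi_1,\ldots,\xi_m$; (C) a finite multiset of oriented 2-paths $(\xi_i\to x_k\to\xi_j)$ with $i\neq j$ passing through even vertices; it is required that no even vertex $x_k$ carries both a 2-path $\xi_i\to x_k\to\xi_j$ and the opposite 2-path $\xi_j\to x_k\to\xi_i$. There are no arrows involving odd vertices other than these 2-paths. Mutation $\widetilde\mu_k$ at an even vertex $x_k$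 changes the extended quiver as follows: (0) the underlying quiver $\mathcal Q$ undergoes the usual Fomin–Zelevinsky quiver mutation at $x_k$; (1* ) for every 2-path $(\xi_i\to x_k\to\xi_j)$ and every arrow $x_k\to x_\ell$ (with multiplicity), a 2-path $(\xi_i\to x_\ell\to\xi_j)$ is added; (2* ) every 2-path through $x_k$ is reversed, $(\xi_i\to x_k\to\xi_j)$ becoming $(\xi_j\to x_k\to\xi_i)$; (3* ) pairs of opposite 2-paths $(\xi_i\to x_\ell\to\xi_j)$ and $(\xi_j\to x_\ell\to\xi_i)$ through the same even vertex are cancelled two by two. Exchange relation: the mutation $\widetilde\mu_k$ replaces $x_k$ by a new even variable $x_k'$, all other variables (including all $\xi_i$) unchanged, where $$x_kx_k'=\prod_{x_k\to x_\ell}x_\ell\;+\;\prod_{\xi_i\to x_k\to\xi_j}(1+\xi_i\xi_j)\prod_{x_\ell\to x_k}x_\ell,$$ the products running over arrows of $\mathcal Q$ and 2-paths of $\widetilde{\mathcal Q}$ with multiplicity. *)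

theory Defs
  imports
    Complex_Main
    "HOL-Library.Poly_Mapping"
    "HOL-Computational_Algebra.Fraction_Field"
begin

section \<open>Grassmann algebras\<close>

text \<open>
  The Grassmann algebra over a commutative ring with odd generators indexed by the natural
  numbers. An element is stored by its coordinates: the value at a finite set
  \<open>S = {i\<^sub>1 < \<dots> < i\<^sub>r}\<close> is the coefficient of the monomial
  \<open>\<xi> i\<^sub>1 * \<dots> * \<xi> i\<^sub>r\<close>.
\<close>

typedef (overloaded) 'a grassmann =
  "{f :: nat set \<Rightarrow> 'a::zero. finite {S. f S \<noteq> 0} \<and> (\<forall>S. infinite S \<longrightarrow> f S = 0)}"
  morphisms gcoeff Abs_grassmann
  by (rule exI[of _ "\<lambda>_. 0"]) simp

setup_lifting type_definition_grassmann

text \<open>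
  For disjoint finite \<open>A\<close> and \<open>B\<close> the product of the ordered monomials of \<open>A\<close> and \<open>B\<close> is
  the ordered monomial of \<open>A \<union> B\<close> times the sign of the shuffle, whose inversions are
  counted here. If \<open>A\<close> and \<open>B\<close> meet, the product is 0, so that only disjoint pairs occur in
  the multiplication.
\<close>

definition shuffle_sign :: "nat set \<Rightarrow> nat set \<Rightarrow> 'a::ring_1" where
  "shuffle_sign A B = (-1) ^ card {(i, j). i \<in> A \<and> j \<in> B \<and> j < i}"

definition gtimes :: "(nat set \<Rightarrow> 'a::ring_1) \<Rightarrow> (nat set \<Rightarrow> 'a) \<Rightarrow> nat set \<Rightarrow> 'a" where
  "gtimes f g S = (\<Sum>T\<in>Pow S. shuffle_sign T (S - T) * f T * g (S - T))"

lemma shuffle_sign_empty [simp]: "shuffle_sign {} A = 1" "shuffle_sign A {} = 1"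
  by (simp_all add: shuffle_sign_def)

lemma finite_inversions:
  "finite A \<Longrightarrow> finite B \<Longrightarrow> finite {(i::nat, j). i \<in> A \<and> j \<in> B \<and> j < i}"
  by (rule finite_subset[of _ "A \<times> B"]) auto

lemma shuffle_sign_Un1:
  assumes "finite A" "finite B" "finite C" "A \<inter> B = {}"
  shows "shuffle_sign (A \<union> B) C = shuffle_sign A C * shuffle_sign B C"
proof -
  have "{(i, j). i \<in> A \<union> B \<and> j \<in> C \<and> j < i} =
    {(i, j). i \<in> A \<and> j \<in> C \<and> j < i} \<union> {(i, j). i \<in> B \<and> j \<in> C \<and> j < i}" by auto
  moreover have "{(i, j). i \<in> A \<and> j \<in> C \<and> j < i} \<inter> {(i, j). i \<in> B \<and> j \<in> C \<and> j < i} = {}"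
    using assms by auto
  ultimately show ?thesis
    using assms by (simp add: shuffle_sign_def card_Un_disjoint finite_inversions power_add)
qed

lemma shuffle_sign_Un2:
  assumes "finite A" "finite B" "finite C" "B \<inter> C = {}"
  shows "shuffle_sign A (B \<union> C) = shuffle_sign A B * shuffle_sign A C"
proof -
  have "{(i, j). i \<in> A \<and> j \<in> B \<union> C \<and> j < i} =
    {(i, j). i \<in> A \<and> j \<in> B \<and> j < i} \<union> {(i, j). i \<in> A \<and> j \<in> C \<and> j < i}" by auto
  moreover have "{(i, j). i \<in> A \<and> j \<in> B \<and> j < i} \<inter> {(i, j). i \<in> A \<and> j \<in> C \<and> j < i} = {}"
    using assms by auto
  ultimately show ?thesis
    using assms by (simp add: shuffle_sign_def card_Un_disjoint finite_inversions power_add)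
qed

lemma shuffle_sign_cocycle:
  assumes "finite A" "finite B" "finite C" "A \<inter> B = {}" "A \<inter> C = {}" "B \<inter> C = {}"
  shows "shuffle_sign (A \<union> B) C * shuffle_sign A B =
    (shuffle_sign A (B \<union> C) * shuffle_sign B C :: 'a::comm_ring_1)"
  using assms by (simp add: shuffle_sign_Un1 shuffle_sign_Un2 mult.assoc mult.left_commute mult.commute)

lemma gtimes_infinite: "infinite S \<Longrightarrow> gtimes f g S = 0"
  by (simp add: gtimes_def)

lemma finite_support_gtimes:
  assumes "finite {S. f S \<noteq> 0}" "finite {S. g S \<noteq> 0}"
  shows "finite {S. gtimes f g S \<noteq> 0}"
proof (rule finite_subset)
  show "finite ((\<lambda>(A, B). A \<union> B) ` ({S. f S \<noteq> 0} \<times> {S. g S \<noteq> 0}))"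
    using assms by simp
  show "{S. gtimes f g S \<noteq> 0} \<subseteq> (\<lambda>(A, B). A \<union> B) ` ({S. f S \<noteq> 0} \<times> {S. g S \<noteq> 0})"
  proof
    fix S assume "S \<in> {S. gtimes f g S \<noteq> 0}"
    then have "gtimes f g S \<noteq> 0" by simp
    then obtain T where T: "T \<in> Pow S" "shuffle_sign T (S - T) * f T * g (S - T) \<noteq> 0"
      unfolding gtimes_def by (rule sum.not_neutral_contains_not_neutral)
    then have "f T \<noteq> 0" "g (S - T) \<noteq> 0" by auto
    moreover have "S = T \<union> (S - T)" using T by auto
    ultimately show "S \<in> (\<lambda>(A, B). A \<union> B) ` ({S. f S \<noteq> 0} \<times> {S. g S \<noteq> 0})"
      by (auto intro!: image_eqI[of _ _ "(T, S - T)"])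
  qed
qed

lemma gtimes_assoc:
  fixes f g h :: "nat set \<Rightarrow> 'a::comm_ring_1"
  shows "gtimes (gtimes f g) h S = gtimes f (gtimes g h) S"
proof (cases "finite S")
  case False
  then show ?thesis by (simp add: gtimes_infinite)
next
  case True
  let ?F = "\<lambda>A B. shuffle_sign (A \<union> B) (S - A - B) * shuffle_sign A B * (f A * g B * h (S - A - B))"
  have "gtimes (gtimes f g) h S = (\<Sum>T\<in>Pow S. \<Sum>A\<in>Pow T. ?F A (T - A))"
    unfolding gtimes_def
  proof (rule sum.cong[OF refl])
    fix T assume "T \<in> Pow S"
    have "shuffle_sign T (S - T) * (\<Sum>A\<in>Pow T. shuffle_sign A (T - A) * f A * g (T - A)) * h (S - T)
      = (\<Sum>A\<in>Pow T. shuffle_sign T (S - T) * (shuffle_sign A (T - A) * f A * g (T - A)) * h (S - T))"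
      by (simp add: sum_distrib_left sum_distrib_right)
    also have "\<dots> = (\<Sum>A\<in>Pow T. ?F A (T - A))"
    proof (rule sum.cong[OF refl])
      fix A assume "A \<in> Pow T"
      then have "A \<union> (T - A) = T" "S - A - (T - A) = S - T" by auto
      then show "shuffle_sign T (S - T) * (shuffle_sign A (T - A) * f A * g (T - A)) * h (S - T)
          = ?F A (T - A)"
        by (simp only: mult.assoc)
    qed
    finally show "shuffle_sign T (S - T) * (\<Sum>A\<in>Pow T. shuffle_sign A (T - A) * f A * g (T - A)) *
      h (S - T) = (\<Sum>A\<in>Pow T. ?F A (T - A))" .
  qed
  also have "\<dots> = (\<Sum>(T, A)\<in>Sigma (Pow S) Pow. ?F A (T - A))"
    using True by (intro sum.Sigma) (auto intro: finite_subset)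
  also have "\<dots> = (\<Sum>(A, B)\<in>Sigma (Pow S) (\<lambda>A. Pow (S - A)). ?F A B)"
    by (rule sum.reindex_bij_witness[of _ "\<lambda>(A, B). (A \<union> B, A)" "\<lambda>(T, A). (A, T - A)"]) auto
  also have "\<dots> = (\<Sum>A\<in>Pow S. \<Sum>B\<in>Pow (S - A). ?F A B)"
    using True by (intro sum.Sigma[symmetric]) auto
  also have "\<dots> = gtimes f (gtimes g h) S"
    unfolding gtimes_def
  proof (rule sum.cong[OF refl])
    fix A assume A: "A \<in> Pow S"
    have "(\<Sum>B\<in>Pow (S - A). ?F A B) = (\<Sum>B\<in>Pow (S - A). shuffle_sign A (S - A) * f A *
      (shuffle_sign B (S - A - B) * g B * h (S - A - B)))"
    proof (rule sum.cong[OF refl])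
      fix B assume B: "B \<in> Pow (S - A)"
      have fin: "finite A" "finite B" "finite (S - A - B)"
        using A B True by (auto intro: finite_subset)
      have eq: "B \<union> (S - A - B) = S - A" using B by auto
      have "shuffle_sign (A \<union> B) (S - A - B) * shuffle_sign A B =
        (shuffle_sign A (S - A) * shuffle_sign B (S - A - B) :: 'a)"
        using shuffle_sign_cocycle[OF fin, where ?'a = 'a] B unfolding eq by auto
      then show "?F A B = shuffle_sign A (S - A) * f A *
          (shuffle_sign B (S - A - B) * g B * h (S - A - B))"
        by (simp add: ac_simps)
    qed
    then show "(\<Sum>B\<in>Pow (S - A). ?F A B) = shuffle_sign A (S - A) * f A *
      (\<Sum>B\<in>Pow (S - A). shuffle_sign B (S - A - B) * g B * h (S - A - B))"
      by (simp add: sum_distrib_left)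
  qed
  finally show ?thesis .
qed

lift_definition gconst :: "'a::zero \<Rightarrow> 'a grassmann" is "\<lambda>a S. if S = {} then a else 0"
  by (auto intro: finite_subset[of _ "{{}}"])

lift_definition \<xi> :: "nat \<Rightarrow> 'a::zero_neq_one grassmann" is "\<lambda>i S. if S = {i} then 1 else 0"
  by auto

instantiation grassmann :: (comm_ring_1) ring_1
begin

lift_definition zero_grassmann :: "'a grassmann" is "\<lambda>_. 0" by simp

lift_definition one_grassmann :: "'a grassmann" is "\<lambda>S. if S = {} then 1 else 0" by simp

lift_definition plus_grassmann :: "'a grassmann \<Rightarrow> 'a grassmann \<Rightarrow> 'a grassmann"
  is "\<lambda>f g S. f S + g S"
proof -
  fix f g :: "nat set \<Rightarrow> 'a"
  assume *: "finite {S. f S \<noteq> 0} \<and> (\<forall>S. infinite S \<longrightarrow> f S = 0)"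
    "finite {S. g S \<noteq> 0} \<and> (\<forall>S. infinite S \<longrightarrow> g S = 0)"
  have "finite {S. f S + g S \<noteq> 0}"
    by (rule finite_subset[of _ "{S. f S \<noteq> 0} \<union> {S. g S \<noteq> 0}"]) (use * in auto)
  then show "finite {S. f S + g S \<noteq> 0} \<and> (\<forall>S. infinite S \<longrightarrow> f S + g S = 0)"
    using * by simp
qed

lift_definition uminus_grassmann :: "'a grassmann \<Rightarrow> 'a grassmann" is "\<lambda>f S. - f S" by simp

lift_definition minus_grassmann :: "'a grassmann \<Rightarrow> 'a grassmann \<Rightarrow> 'a grassmann"
  is "\<lambda>f g S. f S - g S"
proof -
  fix f g :: "nat set \<Rightarrow> 'a"
  assume *: "finite {S. f S \<noteq> 0} \<and> (\<forall>S. infinite S \<longrightarrow> f S = 0)"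
    "finite {S. g S \<noteq> 0} \<and> (\<forall>S. infinite S \<longrightarrow> g S = 0)"
  have "finite {S. f S - g S \<noteq> 0}"
    by (rule finite_subset[of _ "{S. f S \<noteq> 0} \<union> {S. g S \<noteq> 0}"]) (use * in auto)
  then show "finite {S. f S - g S \<noteq> 0} \<and> (\<forall>S. infinite S \<longrightarrow> f S - g S = 0)"
    using * by simp
qed

lift_definition times_grassmann :: "'a grassmann \<Rightarrow> 'a grassmann \<Rightarrow> 'a grassmann" is gtimes
  by (simp add: finite_support_gtimes gtimes_infinite)

instance
proof
  fix a b c :: "'a grassmann"
  show "a + b + c = a + (b + c)" by transfer (simp add: add.assoc)
  show "a + b = b + a" by transfer (simp add: add.commute)
  show "0 + a = a" by transfer simp
  show "- a + a = 0" by transfer simp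
  show "a - b = a + - b" by transfer simp
  show "a * b * c = a * (b * c)" by transfer (simp add: fun_eq_iff gtimes_assoc)
  show "(a + b) * c = a * c + b * c"
    by transfer (simp add: gtimes_def fun_eq_iff algebra_simps sum.distrib)
  show "a * (b + c) = a * b + a * c"
    by transfer (simp add: gtimes_def fun_eq_iff algebra_simps sum.distrib)
  show "1 * a = a"
  proof (transfer, rule ext)
    fix f :: "nat set \<Rightarrow> 'a" and S
    assume f: "finite {S. f S \<noteq> 0} \<and> (\<forall>S. infinite S \<longrightarrow> f S = 0)"
    show "gtimes (\<lambda>S. if S = {} then 1 else 0) f S = f S"
    proof (cases "finite S")
      case True
      have "gtimes (\<lambda>S. if S = {} then 1 else 0) f S = (\<Sum>T\<in>Pow S. if T = {} then f S else 0)"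
        unfolding gtimes_def by (rule sum.cong) auto
      then show ?thesis using True by simp
    qed (use f in \<open>simp add: gtimes_infinite\<close>)
  qed
  show "a * 1 = a"
  proof (transfer, rule ext)
    fix f :: "nat set \<Rightarrow> 'a" and S
    assume f: "finite {S. f S \<noteq> 0} \<and> (\<forall>S. infinite S \<longrightarrow> f S = 0)"
    show "gtimes f (\<lambda>S. if S = {} then 1 else 0) S = f S"
    proof (cases "finite S")
      case True
      have "gtimes f (\<lambda>S. if S = {} then 1 else 0) S = (\<Sum>T\<in>Pow S. if T = S then f S else 0)"
        unfolding gtimes_def by (rule sum.cong) auto
      then show ?thesis using True by simp
    qed (use f in \<open>simp add: gtimes_infinite\<close>)
  qed
  show "(0::'a grassmann) \<noteq> 1" by transfer (auto simp: fun_eq_iff)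
qed

end

lemma gconst_0 [simp]: "gconst 0 = 0"
  by transfer simp

lemma gconst_1 [simp]: "gconst 1 = 1"
  by transfer simp

lemma gconst_add: "gconst (a + b) = gconst a + gconst b"
  by transfer auto

lemma gconst_times_coeff: "gcoeff (gconst a * u) S = a * gcoeff u S"
proof (transfer)
  fix a :: 'a and f :: "nat set \<Rightarrow> 'a" and S
  assume f: "finite {S. f S \<noteq> 0} \<and> (\<forall>S. infinite S \<longrightarrow> f S = 0)"
  show "gtimes (\<lambda>S. if S = {} then a else 0) f S = a * f S"
  proof (cases "finite S")
    case True
    have "gtimes (\<lambda>S. if S = {} then a else 0) f S = (\<Sum>T\<in>Pow S. if T = {} then a * f S else 0)"
      unfolding gtimes_def by (rule sum.cong) auto
    then show ?thesis using True by simp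
  qed (use f in \<open>simp add: gtimes_infinite\<close>)
qed

lemma times_gconst_coeff: "gcoeff (u * gconst a) S = a * gcoeff u S"
proof (transfer)
  fix a :: 'a and f :: "nat set \<Rightarrow> 'a" and S
  assume f: "finite {S. f S \<noteq> 0} \<and> (\<forall>S. infinite S \<longrightarrow> f S = 0)"
  show "gtimes f (\<lambda>S. if S = {} then a else 0) S = a * f S"
  proof (cases "finite S")
    case True
    have "gtimes f (\<lambda>S. if S = {} then a else 0) S = (\<Sum>T\<in>Pow S. if T = S then a * f S else 0)"
      unfolding gtimes_def by (rule sum.cong) auto
    then show ?thesis using True by simp
  qed (use f in \<open>simp add: gtimes_infinite\<close>)
qed

lemma gconst_central: "gconst a * u = u * gconst a"
  by (simp add: gcoeff_inject[symmetric] fun_eq_iff gconst_times_coeff times_gconst_coeff)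

lemma gconst_mult: "gconst (a * b) = gconst a * gconst b"
  by (auto simp: gcoeff_inject[symmetric] fun_eq_iff gconst_times_coeff gconst.rep_eq)

lemma gtimes_\<xi>:
  "gcoeff (\<xi> i * \<xi> j :: 'a::comm_ring_1 grassmann) S =
    (if i \<noteq> j \<and> S = {i, j} then shuffle_sign {i} {j} else 0)"
proof -
  have "gcoeff (\<xi> i * \<xi> j :: 'a grassmann) S =
    (\<Sum>T\<in>Pow S. if T = {i} then (if S - {i} = {j} then shuffle_sign {i} {j} else 0) else 0)"
    unfolding times_grassmann.rep_eq gtimes_def \<xi>.rep_eq by (rule sum.cong) auto
  also have "\<dots> = (if i \<noteq> j \<and> S = {i, j} then shuffle_sign {i} {j} else 0)"
  proof (cases "finite S")
    case True
    then show ?thesis by (auto simp: sum.delta')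
  next
    case False
    then show ?thesis by (auto dest: finite_subset)
  qed
  finally show ?thesis .
qed

lemma \<xi>_anticommute: "\<xi> i * \<xi> j = - (\<xi> j * \<xi> i :: 'a::comm_ring_1 grassmann)"
proof -
  have eq: "{(a, b). a = i \<and> b = j \<and> b < a} = (if j < i then {(i, j)} else {})" for i j :: nat
    by auto
  show ?thesis
    by (auto simp: gcoeff_inject[symmetric] fun_eq_iff uminus_grassmann.rep_eq gtimes_\<xi>
        shuffle_sign_def eq insert_commute)
qed

lemma \<xi>_square: "\<xi> i * \<xi> i = (0 :: 'a::comm_ring_1 grassmann)"
  by (simp add: gcoeff_inject[symmetric] fun_eq_iff zero_grassmann.rep_eq gtimes_\<xi>)


section \<open>The ambient superalgebra\<close>

text \<open>
  Complex rational functions in variables indexed by the natural numbers. A quiver with \<open>n\<close> even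
  and \<open>m\<close> odd vertices only uses the variables with index below \<open>n\<close> and \<open>m\<close>, respectively.
\<close>

type_synonym ratfun = "((nat \<Rightarrow>\<^sub>0 nat) \<Rightarrow>\<^sub>0 complex) fract"

definition cst :: "complex \<Rightarrow> ratfun" where
  "cst c = Fract (Poly_Mapping.single 0 c) 1"

definition X :: "nat \<Rightarrow> ratfun" where
  "X i = Fract (Poly_Mapping.single (Poly_Mapping.single i 1) 1) 1"

inductive_set super_laurent :: "nat \<Rightarrow> nat \<Rightarrow> ratfun grassmann set" for n m :: nat where
  const: "gconst (cst c) \<in> super_laurent n m"
| even: "i < n \<Longrightarrow> gconst (X i) \<in> super_laurent n m"
| even_inverse: "i < n \<Longrightarrow> gconst (inverse (X i)) \<in> super_laurent n m"
| odd: "j < m \<Longrightarrow> \<xi> j \<in> super_laurent n m"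
| add: "u \<in> super_laurent n m \<Longrightarrow> v \<in> super_laurent n m \<Longrightarrow> u + v \<in> super_laurent n m"
| mult: "u \<in> super_laurent n m \<Longrightarrow> v \<in> super_laurent n m \<Longrightarrow> u * v \<in> super_laurent n m"


section \<open>Extended quivers and their mutations\<close>

text \<open>
  Multiplicities: \<open>arrows Q k l\<close> counts the arrows from \<open>x\<^sub>k\<close> to \<open>x\<^sub>l\<close>, and
  \<open>paths Q k i j\<close> counts the 2-paths from \<open>\<xi>\<^sub>i\<close> through \<open>x\<^sub>k\<close> to \<open>\<xi>\<^sub>j\<close>.
\<close>

record ext_quiver =
  arrows :: "nat \<Rightarrow> nat \<Rightarrow> nat"
  paths :: "nat \<Rightarrow> nat \<Rightarrow> nat \<Rightarrow> nat"

definition extended_quiver :: "nat \<Rightarrow> nat \<Rightarrow> ext_quiver \<Rightarrow> bool" where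
  "extended_quiver n m Q \<longleftrightarrow>
    (\<forall>k l. arrows Q k l > 0 \<longrightarrow> k < n \<and> l < n) \<and>
    (\<forall>k. arrows Q k k = 0) \<and>
    (\<forall>k l. \<not> (arrows Q k l > 0 \<and> arrows Q l k > 0)) \<and>
    (\<forall>k i j. paths Q k i j > 0 \<longrightarrow> k < n \<and> i < m \<and> j < m \<and> i \<noteq> j) \<and>
    (\<forall>k i j. \<not> (paths Q k i j > 0 \<and> paths Q k j i > 0))"

text \<open>
  The three steps of Fomin--Zelevinsky mutation: an arrow \<open>i \<rightarrow> j\<close> is added for each path
  \<open>i \<rightarrow> k \<rightarrow> j\<close>, the arrows at \<open>k\<close> are reversed, and 2-cycles are cancelled. The subtraction
  in the last step is truncated.
\<close>

definition mutate_arrows :: "nat \<Rightarrow> (nat \<Rightarrow> nat \<Rightarrow> nat) \<Rightarrow> nat \<Rightarrow> nat \<Rightarrow> nat" where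
  "mutate_arrows k a =
    (let a1 = (\<lambda>i j. a i j + a i k * a k j);
         a2 = (\<lambda>i j. if i = k \<or> j = k then a1 j i else a1 i j)
     in (\<lambda>i j. a2 i j - a2 j i))"

text \<open>
  Likewise for 2-paths. The arrows \<open>a\<close> are those of the quiver before its own mutation.
\<close>

definition mutate_paths ::
    "nat \<Rightarrow> (nat \<Rightarrow> nat \<Rightarrow> nat) \<Rightarrow> (nat \<Rightarrow> nat \<Rightarrow> nat \<Rightarrow> nat) \<Rightarrow> nat \<Rightarrow> nat \<Rightarrow> nat \<Rightarrow> nat" where
  "mutate_paths k a p =
    (let p1 = (\<lambda>l i j. p l i j + p k i j * a k l);
         p2 = (\<lambda>l i j. if l = k then p1 l j i else p1 l i j)
     in (\<lambda>l i j. p2 l i j - p2 l j i))"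

definition mutate_quiver :: "nat \<Rightarrow> ext_quiver \<Rightarrow> ext_quiver" where
  "mutate_quiver k Q =
    \<lparr>arrows = mutate_arrows k (arrows Q), paths = mutate_paths k (arrows Q) (paths Q)\<rparr>"

text \<open>
  Products are taken over lists because the superalgebra is not commutative. The factors are even
  and commute, so the order of the lists plays no role.
\<close>

definition exchange_rhs ::
    "nat \<Rightarrow> nat \<Rightarrow> ext_quiver \<Rightarrow> (nat \<Rightarrow> ratfun grassmann) \<Rightarrow> nat \<Rightarrow> ratfun grassmann" where
  "exchange_rhs n m Q x k =
    prod_list (map (\<lambda>l. x l ^ arrows Q k l) [0..<n]) +
    prod_list (map (\<lambda>(i, j). (1 + \<xi> i * \<xi> j) ^ paths Q k i j) (List.product [0..<m] [0..<m])) *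
    prod_list (map (\<lambda>l. x l ^ arrows Q l k) [0..<n])"

text \<open>
  The new variable is the solution \<open>y\<close> of the exchange relation. A definite description is
  unspecified unless there is exactly one solution, so a statement about the new variable
  includes that the division by \<open>x k\<close> is possible and unambiguous.
\<close>

definition mutate ::
    "nat \<Rightarrow> nat \<Rightarrow> nat \<Rightarrow> ext_quiver \<times> (nat \<Rightarrow> ratfun grassmann) \<Rightarrow>
     ext_quiver \<times> (nat \<Rightarrow> ratfun grassmann)" where
  "mutate n m k = (\<lambda>(Q, x).
    (mutate_quiver k Q, x(k := (THE y. x k * y = exchange_rhs n m Q x k))))"

definition initial_seed :: "ext_quiver \<Rightarrow> ext_quiver \<times> (nat \<Rightarrow> ratfun grassmann)" where
  "initial_seed Q = (Q, \<lambda>i. gconst (X i))"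

text \<open>The mutations are performed in the order in which they occur in the list.\<close>

definition cluster ::
    "nat \<Rightarrow> nat \<Rightarrow> ext_quiver \<Rightarrow> nat list \<Rightarrow> nat \<Rightarrow> ratfun grassmann" where
  "cluster n m Q ks = snd (fold (mutate n m) ks (initial_seed Q))"

end

theory Submission
  imports Defs
begin

text \<open>
  Since \<open>1 + \<xi> i * \<xi> j\<close> is the exponential of \<open>\<xi> i * \<xi> j\<close>, the product over the 2-paths through an even
  vertex is multiplicative in the multiplicities, and the mutation rule of the 2-paths is the
  rule for coefficients in a (non-normalized) cluster algebra. Such coefficients come from
  frozen vertices, one for each even vertex, up to rescaling the variables by
  monomials in the coefficients. This reduces the claim to the Laurent phenomenon for ordinary
  quivers. The division by the current variable is unambiguous because its body is subtraction-free,
  hence nonzero.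

  The Laurent phenomenon is proved by induction on the number of mutations. If the first three seeds
  are reached by mutations in directions \<open>j\<close> and \<open>k\<close>, then the final variable is a Laurent polynomial in
  the seed after the mutation at \<open>j\<close> and in the seed after the mutations at \<open>j, k, j\<close>. In terms
  of the initial seed this bounds its denominator by a power of \<open>f\<close> and also by a power of \<open>g * h\<close>,
  where \<open>f, g, h\<close> are the three new variables. A frozen vertex attached to \<open>k\<close> makes \<open>g * h\<close> a
  nonzerodivisor modulo \<open>f\<close>, so that both denominators are trivial; afterwards the frozen variable is
  set to 1.
\<close>

section \<open>Monoid rings and their evaluations\<close>

abbreviation mlookup :: "('a \<Rightarrow>\<^sub>0 'b::zero) \<Rightarrow> 'a \<Rightarrow> 'b" where
  "mlookup \<equiv> Poly_Mapping.lookup"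

abbreviation msingle :: "'a \<Rightarrow> 'b \<Rightarrow> 'a \<Rightarrow>\<^sub>0 'b::zero" where
  "msingle \<equiv> Poly_Mapping.single"

abbreviation mkeys :: "('a \<Rightarrow>\<^sub>0 'b::zero) \<Rightarrow> 'a set" where
  "mkeys \<equiv> Poly_Mapping.keys"

lemma poly_mapping_sum_singles: "(\<Sum>a\<in>mkeys p. msingle a (mlookup p a)) = p"
  by (rule poly_mapping_eqI)
    (auto simp: lookup_sum lookup_single when_def sum.delta in_keys_iff)

text \<open>The target may be noncommutative, because the same evaluation serves fields and the
  Grassmann algebra. Central coefficients suffice: the values of \<open>\<phi>\<close> commute with
  each other, since addition of exponents is commutative.\<close>

locale monoid_ring_eval =
  fixes \<gamma> :: "'c::comm_ring_1 \<Rightarrow> 'r::ring_1" and \<phi> :: "'a::comm_monoid_add \<Rightarrow> 'r"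
  assumes coeff_add: "\<gamma> (c + d) = \<gamma> c + \<gamma> d"
    and coeff_mult: "\<gamma> (c * d) = \<gamma> c * \<gamma> d"
    and coeff_one: "\<gamma> 1 = 1"
    and coeff_central: "\<gamma> c * r = r * \<gamma> c"
    and mon_zero: "\<phi> 0 = 1"
    and mon_add: "\<phi> (a + b) = \<phi> a * \<phi> b"
begin

definition ev :: "('a \<Rightarrow>\<^sub>0 'c) \<Rightarrow> 'r" where
  "ev p = (\<Sum>a\<in>mkeys p. \<gamma> (mlookup p a) * \<phi> a)"

lemma coeff_zero: "\<gamma> 0 = 0"
  using coeff_add[of 0 0] by simp

lemma ev_superset:
  assumes "finite A" "mkeys p \<subseteq> A"
  shows "ev p = (\<Sum>a\<in>A. \<gamma> (mlookup p a) * \<phi> a)"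
  unfolding ev_def using assms by (intro sum.mono_neutral_left) (auto simp: in_keys_iff coeff_zero)

lemma ev_zero [simp]: "ev 0 = 0"
  by (simp add: ev_def)

lemma ev_single: "ev (msingle a c) = \<gamma> c * \<phi> a"
  by (cases "c = 0") (simp_all add: ev_def coeff_zero)

lemma ev_one [simp]: "ev 1 = 1"
  using ev_single[of 0 1] by (simp add: coeff_one mon_zero)

lemma ev_add: "ev (p + q) = ev p + ev q"
proof -
  have "ev (p + q) = (\<Sum>a\<in>mkeys p \<union> mkeys q. \<gamma> (mlookup (p + q) a) * \<phi> a)"
    by (rule ev_superset) (auto dest: set_mp[OF keys_add])
  also have "\<dots> = ev p + ev q"
    by (simp add: ev_superset[of "mkeys p \<union> mkeys q"] lookup_add coeff_add algebra_simps sum.distrib)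
  finally show ?thesis .
qed

lemma ev_sum: "ev (sum f A) = (\<Sum>a\<in>A. ev (f a))"
  by (induction A rule: infinite_finite_induct) (simp_all add: ev_add)

lemma ev_mult: "ev (p * q) = ev p * ev q"
proof -
  have "p * q = (\<Sum>a\<in>mkeys p. msingle a (mlookup p a)) * (\<Sum>b\<in>mkeys q. msingle b (mlookup q b))"
    by (simp only: poly_mapping_sum_singles)
  also have "\<dots> = (\<Sum>a\<in>mkeys p. \<Sum>b\<in>mkeys q. msingle (a + b) (mlookup p a * mlookup q b))"
    by (simp add: sum_product mult_single)
  finally have "ev (p * q) = (\<Sum>a\<in>mkeys p. \<Sum>b\<in>mkeys q. \<gamma> (mlookup p a * mlookup q b) * \<phi> (a + b))"
    by (simp add: ev_sum ev_single)
  also have "\<dots> = (\<Sum>a\<in>mkeys p. \<Sum>b\<in>mkeys q. (\<gamma> (mlookup p a) * \<phi> a) * (\<gamma> (mlookup q b) * \<phi> b))"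
    by (intro sum.cong refl) (metis coeff_mult mon_add coeff_central mult.assoc)
  also have "\<dots> = ev p * ev q"
    by (simp add: ev_def sum_product)
  finally show ?thesis .
qed

lemma ev_power: "ev (p ^ i) = ev p ^ i"
  by (induction i) (simp_all add: ev_mult)

lemma ev_closed:
  assumes "\<And>c. \<gamma> c \<in> A" "\<And>a. \<phi> a \<in> A"
    and "\<And>u v. u \<in> A \<Longrightarrow> v \<in> A \<Longrightarrow> u + v \<in> A" "\<And>u v. u \<in> A \<Longrightarrow> v \<in> A \<Longrightarrow> u * v \<in> A"
  shows "ev p \<in> A"
proof -
  \<comment> \<open>The instance \<open>c = 0\<close> of the first assumption puts 0 into
    \<open>A\<close>; this is the value of the empty sum and the default value for infinite
    \<open>B\<close>.\<close>
  have "(\<Sum>a\<in>B. \<gamma> (mlookup p a) * \<phi> a) \<in> A" for B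
    using assms assms(1)[of 0] by (induction B rule: infinite_finite_induct) (auto simp: coeff_zero)
  then show ?thesis unfolding ev_def .
qed

end

section \<open>Integer Laurent polynomials and their values in a field\<close>

type_synonym laurent = "(nat \<Rightarrow>\<^sub>0 int) \<Rightarrow>\<^sub>0 int"

definition monomial_value :: "(nat \<Rightarrow> 'a::field) \<Rightarrow> (nat \<Rightarrow>\<^sub>0 int) \<Rightarrow> 'a" where
  "monomial_value x a = (\<Prod>i\<in>mkeys a. x i powi mlookup a i)"

lemma monomial_value_superset:
  assumes "finite A" "mkeys a \<subseteq> A"
  shows "monomial_value x a = (\<Prod>i\<in>A. x i powi mlookup a i)"
  unfolding monomial_value_def using assms
  by (intro prod.mono_neutral_left) (auto simp: in_keys_iff)

lemma monomial_value_zero [simp]: "monomial_value x 0 = 1"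
  by (simp add: monomial_value_def)

lemma monomial_value_add:
  assumes "\<And>i. x i \<noteq> 0"
  shows "monomial_value x (a + b) = monomial_value x a * monomial_value x b"
proof -
  have "mkeys (a + b) \<subseteq> mkeys a \<union> mkeys b" by (rule keys_add)
  then show ?thesis
    using assms by (simp add: monomial_value_superset[of "mkeys a \<union> mkeys b"] lookup_add power_int_add
        prod.distrib)
qed

lemma monomial_value_single: "monomial_value x (msingle i k) = x i powi k"
  by (cases "k = 0") (simp_all add: monomial_value_def)

definition laurent_eval :: "(nat \<Rightarrow> 'a::field) \<Rightarrow> laurent \<Rightarrow> 'a" where
  "laurent_eval x = monoid_ring_eval.ev of_int (monomial_value x)"

lemma monoid_ring_eval_field:
  assumes "\<And>i. x i \<noteq> (0::'a::field)"
  shows "monoid_ring_eval (of_int :: int \<Rightarrow> 'a) (monomial_value x)"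
  by standard (use assms in \<open>simp_all add: monomial_value_add mult.commute\<close>)

text \<open>Closure under differences yields 0, sums and all integers, so the conditions make
  \<open>A\<close> a subring. It is applied to the Laurent polynomials inside their fraction field
  and to a localization by one element.\<close>

lemma laurent_eval_closed:
  assumes nz: "\<And>i. x i \<noteq> (0::'a::field)"
    and A: "1 \<in> A" "\<And>u v. u \<in> A \<Longrightarrow> v \<in> A \<Longrightarrow> u - v \<in> A" "\<And>u v. u \<in> A \<Longrightarrow> v \<in> A \<Longrightarrow> u * v \<in> A"
    and x: "\<And>i. x i \<in> A" "\<And>i. inverse (x i) \<in> A"
  shows "laurent_eval x p \<in> A"
proof -
  interpret monoid_ring_eval "of_int :: int \<Rightarrow> 'a" "monomial_value x"
    by (rule monoid_ring_eval_field) (rule nz)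
  have zero: "0 \<in> A" using A(2)[OF A(1) A(1)] by simp
  have plus: "u + v \<in> A" if "u \<in> A" "v \<in> A" for u v
    using A(2)[OF that(1) A(2)[OF zero that(2)]] by simp
  have pow: "u ^ i \<in> A" if "u \<in> A" for u i
    using that by (induction i) (auto intro: A)
  have nat: "of_nat i \<in> A" for i
    by (induction i) (auto intro: A plus zero)
  have "of_int c \<in> A" for c
    by (cases c rule: int_diff_cases) (simp add: A(2) nat)
  moreover have "x i powi k \<in> A" for i k
    using x pow by (simp add: power_int_def)
  then have "monomial_value x a \<in> A" for a
  proof -
    assume *: "\<And>i k. x i powi k \<in> A"
    have "(\<Prod>i\<in>B. x i powi mlookup a i) \<in> A" for B
      by (induction B rule: infinite_finite_induct) (auto intro: A *)
    then show ?thesis by (simp add: monomial_value_def)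
  qed
  ultimately show ?thesis
    unfolding laurent_eval_def by (rule ev_closed) (auto intro: A plus)
qed

text \<open>Seeds live in the fraction field, where mutation can divide; being a Laurent polynomial
  then means lying in \<open>range emb\<close>.\<close>

definition emb :: "'a::idom \<Rightarrow> 'a fract" where
  "emb p = Fract p 1"

lemma emb_zero [simp]: "emb 0 = 0"
  and emb_one [simp]: "emb 1 = 1"
  and emb_add: "emb (p + q) = emb p + emb q"
  and emb_mult: "emb (p * q) = emb p * emb q"
  and emb_minus: "emb (p - q) = emb p - emb q"
  and emb_eq_iff [simp]: "emb p = emb q \<longleftrightarrow> p = q"
  and emb_eq_0_iff [simp]: "emb p = 0 \<longleftrightarrow> p = 0"
  by (simp_all add: emb_def Zero_fract_def One_fract_def eq_fract)

lemma emb_power: "emb (p ^ i) = emb p ^ i"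
  by (induction i) (simp_all add: emb_mult)

lemma emb_prod: "emb (\<Prod>i\<in>A. f i) = (\<Prod>i\<in>A. emb (f i))"
  by (induction A rule: infinite_finite_induct) (simp_all add: emb_mult)

section \<open>Subtraction-free sets\<close>

text \<open>Membership in such a set certifies that no mutation divides by zero.\<close>

definition subtraction_free :: "'a::field set \<Rightarrow> bool" where
  "subtraction_free P \<longleftrightarrow> 0 \<notin> P \<and> 1 \<in> P \<and>
    (\<forall>a\<in>P. \<forall>b\<in>P. a + b \<in> P \<and> a * b \<in> P \<and> a / b \<in> P)"

text \<open>Used with \<open>\<sigma>\<close> the evaluation that sends all variables to 1. Values
  are complex so that integer and complex coefficients are covered alike.\<close>

definition pos_quot :: "('a::idom \<Rightarrow> complex) \<Rightarrow> 'a fract set" where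
  "pos_quot \<sigma> = {Fract p q |p q. (\<exists>r>0. \<sigma> p = of_real r) \<and> (\<exists>r>0. \<sigma> q = of_real r)}"

text \<open>An element of positive value is nonzero. Hence the denominators are legitimate, the
  fractions can be inverted, and 0 is not among them.\<close>

lemma pos_quot_subtraction_free:
  assumes add: "\<And>p q. \<sigma> (p + q) = \<sigma> p + \<sigma> q" and mult: "\<And>p q. \<sigma> (p * q) = \<sigma> p * \<sigma> q"
    and one: "\<sigma> 1 = 1"
  shows "subtraction_free (pos_quot \<sigma>)"
proof -
  define R where "R = {p. \<exists>r>0. \<sigma> p = complex_of_real r}"
  have zero: "\<sigma> 0 = 0" using add[of 0 0] by simp
  have nz: "0 \<notin> R" by (auto simp: R_def zero)
  have one: "1 \<in> R" by (auto simp: R_def one intro!: exI[of _ 1])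
  have RI: "p + q \<in> R" "p * q \<in> R" if pq: "p \<in> R" "q \<in> R" for p q
  proof -
    obtain r s where rs: "r > 0" "s > 0" "\<sigma> p = of_real r" "\<sigma> q = of_real s"
      using pq by (auto simp: R_def)
    have "\<sigma> (p + q) = of_real (r + s)" "\<sigma> (p * q) = of_real (r * s)"
      using rs by (simp_all add: add mult)
    moreover have "r + s > 0" "r * s > 0" using rs by auto
    ultimately show "p + q \<in> R" "p * q \<in> R" unfolding R_def by blast+
  qed
  have eq: "pos_quot \<sigma> = {Fract p q |p q. p \<in> R \<and> q \<in> R}"
    by (auto simp: pos_quot_def R_def)
  show ?thesis
    unfolding subtraction_free_def
  proof (intro conjI ballI)
    show "0 \<notin> pos_quot \<sigma>"
      using nz by (auto simp: eq Zero_fract_def eq_fract) (metis eq_fract(1) mult_zero_left mult.right_neutral zero_neq_one)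
    show "1 \<in> pos_quot \<sigma>" using one by (auto simp: eq One_fract_def)
    fix a b assume "a \<in> pos_quot \<sigma>" "b \<in> pos_quot \<sigma>"
    then obtain p q r s where *: "a = Fract p q" "b = Fract r s" "p \<in> R" "q \<in> R" "r \<in> R" "s \<in> R"
      by (auto simp: eq)
    then have "q \<noteq> 0" "s \<noteq> 0" using nz by auto
    then have "a + b = Fract (p * s + r * q) (q * s)" "a * b = Fract (p * r) (q * s)"
      "a / b = Fract (p * s) (q * r)"
      using * by simp_all
    with * RI show "a + b \<in> pos_quot \<sigma>" "a * b \<in> pos_quot \<sigma>" "a / b \<in> pos_quot \<sigma>"
      unfolding eq by blast+
  qed
qed


section \<open>Seeds and their mutations\<close>

text \<open>Fomin--Zelevinsky matrix mutation; a positive entry \<open>b i j\<close> counts arrows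
  from \<open>i\<close> to \<open>j\<close>, a negative one the opposite arrows.\<close>

definition mut_mat :: "nat \<Rightarrow> (nat \<Rightarrow> nat \<Rightarrow> int) \<Rightarrow> nat \<Rightarrow> nat \<Rightarrow> int" where
  "mut_mat k b i j = (if i = k \<or> j = k then - b i j
     else b i j + max 0 (b i k) * max 0 (b k j) - max 0 (- b i k) * max 0 (- b k j))"

text \<open>Typed over semirings so that it makes sense for Laurent polynomials as well as for
  elements of the fraction field.\<close>

definition exch :: "nat \<Rightarrow> (nat \<Rightarrow> nat \<Rightarrow> int) \<Rightarrow> (nat \<Rightarrow> 'a::comm_semiring_1) \<Rightarrow> nat \<Rightarrow> 'a" where
  "exch N b x k = (\<Prod>l<N. x l ^ nat (b k l)) + (\<Prod>l<N. x l ^ nat (- b k l))"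

definition mut_seed :: "nat \<Rightarrow> nat \<Rightarrow> (nat \<Rightarrow> nat \<Rightarrow> int) \<times> (nat \<Rightarrow> 'a::field) \<Rightarrow>
    (nat \<Rightarrow> nat \<Rightarrow> int) \<times> (nat \<Rightarrow> 'a)" where
  "mut_seed N k = (\<lambda>(b, x). (mut_mat k b, x(k := exch N b x k / x k)))"

lemma mut_seed_simp [simp]: "mut_seed N k (b, x) = (mut_mat k b, x(k := exch N b x k / x k))"
  by (simp add: mut_seed_def)

definition skew :: "(nat \<Rightarrow> nat \<Rightarrow> int) \<Rightarrow> bool" where
  "skew b \<longleftrightarrow> (\<forall>i j. b i j = - b j i)"

lemma skewD: "skew b \<Longrightarrow> b i j = - b j i"
  unfolding skew_def by blast

lemma skew_diag: "skew b \<Longrightarrow> b i i = 0"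
  by (drule skewD[of b i i]) linarith

lemma skew_mut_mat:
  assumes "skew b" shows "skew (mut_mat k b)"
  unfolding skew_def
proof (intro allI)
  fix i j
  show "mut_mat k b i j = - mut_mat k b j i"
  proof -
    have *: "b j i = - b i j" "b k i = - b i k" "b j k = - b k j"
      using assms by (rule skewD)+
    show ?thesis
    proof (cases "i = k \<or> j = k")
      case True
      then have "mut_mat k b i j = - b i j" "mut_mat k b j i = - b j i" by (auto simp: mut_mat_def)
      then show ?thesis using *(1) by linarith
    next
      case False
      then show ?thesis by (simp add: mut_mat_def * mult.commute)
    qed
  qed
qed

lemma mut_mat_invol: "mut_mat k (mut_mat k b) = b"
  by (rule ext)+ (simp add: mut_mat_def)

lemma mut_mat_uminus: "mut_mat k (\<lambda>i j. - b i j) = (\<lambda>i j. - mut_mat k b i j)"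
  by (rule ext)+ (simp add: mut_mat_def)

lemma exch_uminus: "exch N (\<lambda>i j. - b i j) x = exch N b x"
  by (rule ext) (simp add: exch_def add.commute)

text \<open>Reversing all arrows only swaps the two monomials of each exchange relation. Later this
  allows the sign of one matrix entry to be chosen.\<close>

lemma fold_mut_seed_uminus:
  "fold (mut_seed N) ks ((\<lambda>i j. - b i j), x) =
    (\<lambda>(b, x). ((\<lambda>i j. - b i j), x)) (fold (mut_seed N) ks (b, x))"
  by (induction ks arbitrary: b x) (simp_all add: mut_mat_uminus exch_uminus)

lemma fst_fold_mut_seed: "fst (fold (mut_seed N) ks (b, x)) = fold mut_mat ks b"
  by (induction ks arbitrary: b x) simp_all

lemma skew_fold: "skew b \<Longrightarrow> skew (fold mut_mat ks b)"
  by (induction ks arbitrary: b) (simp_all add: skew_mut_mat)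

lemma exch_cong:
  assumes "\<And>l. l < N \<Longrightarrow> b k l = b' k l" "\<And>l. l < N \<Longrightarrow> b k l \<noteq> 0 \<Longrightarrow> x l = x' l"
  shows "exch N b x k = exch N b' x' k"
proof -
  have "x l ^ nat (b k l) = x' l ^ nat (b' k l)" "x l ^ nat (- b k l) = x' l ^ nat (- b' k l)"
    if "l < N" for l
    using assms(1)[OF that] assms(2)[OF that] by (cases "b k l = 0"; simp)+
  then show ?thesis by (simp add: exch_def)
qed

text \<open>By skew-symmetry \<open>b k k\<close> is 0, so the exchange polynomial does not involve
  the variable at \<open>k\<close>. Negating row \<open>k\<close> swaps its two monomials, so the
  second division undoes the first.\<close>

lemma mut_seed_invol:
  assumes "skew b" "x k \<noteq> 0" "exch N b x k \<noteq> 0"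
  shows "mut_seed N k (mut_seed N k (b, x)) = (b, x)"
proof -
  have "exch N (mut_mat k b) (x(k := y)) k = exch N (\<lambda>i j. - b i j) x k" for y
    by (rule exch_cong) (use skew_diag[OF assms(1), of k] in \<open>auto simp: mut_mat_def\<close>)
  then show ?thesis
    using assms by (simp add: mut_mat_invol exch_uminus)
qed

lemma subtraction_freeD:
  assumes "subtraction_free P"
  shows "0 \<notin> P" "1 \<in> P" "a \<in> P \<Longrightarrow> b \<in> P \<Longrightarrow> a + b \<in> P"
    "a \<in> P \<Longrightarrow> b \<in> P \<Longrightarrow> a * b \<in> P" "a \<in> P \<Longrightarrow> b \<in> P \<Longrightarrow> a / b \<in> P"
  using assms by (auto simp: subtraction_free_def)

lemma exch_subtraction_free:
  assumes "subtraction_free P" "\<And>i. x i \<in> P"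
  shows "exch N b x k \<in> P"
proof -
  have pow: "u ^ i \<in> P" if "u \<in> P" for u i
    using that by (induction i) (auto intro: subtraction_freeD[OF assms(1)])
  have "(\<Prod>l\<in>B. x l ^ e l) \<in> P" for B e
    by (induction B rule: infinite_finite_induct)
      (auto intro: subtraction_freeD[OF assms(1)] pow assms(2))
  then show ?thesis unfolding exch_def by (intro subtraction_freeD[OF assms(1)])
qed

lemma fold_subtraction_free:
  assumes "subtraction_free P" "\<And>i. x i \<in> P"
  shows "snd (fold (mut_seed N) ks (b, x)) i \<in> P"
  using assms(2)
proof (induction ks arbitrary: b x i)
  case (Cons k ks)
  have *: "(x(k := exch N b x k / x k)) i \<in> P" for i
    using Cons.prems by (auto intro: subtraction_freeD[OF assms(1)] exch_subtraction_free[OF assms(1)])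
  have "snd (fold (mut_seed N) ks (mut_mat k b, x(k := exch N b x k / x k))) i \<in> P"
    by (rule Cons.IH) (rule *)
  then show ?case by simp
qed simp

lemma prod_split_two:
  fixes g :: "nat \<Rightarrow> 'a::comm_monoid_mult"
  assumes "j < N" "k < N" "j \<noteq> k"
  shows "(\<Prod>l<N. g l) = g j * g k * (\<Prod>l\<in>{..<N} - {j, k}. g l)"
proof -
  have "{..<N} - {j} - {k} = {..<N} - {j, k}" by auto
  then show ?thesis
    using prod.remove[of "{..<N}" j g] prod.remove[of "{..<N} - {j}" k g] assms
    by (simp add: mult.assoc)
qed

lemma exch_split_two:
  assumes "j < N" "k < N" "j \<noteq> k"
  shows "exch N b x i = x j ^ nat (b i j) * x k ^ nat (b i k) * (\<Prod>l\<in>{..<N} - {j, k}. x l ^ nat (b i l))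
    + x j ^ nat (- b i j) * x k ^ nat (- b i k) * (\<Prod>l\<in>{..<N} - {j, k}. x l ^ nat (- b i l))"
  by (simp add: exch_def prod_split_two[OF assms])

text \<open>
  The first three mutations in directions \<open>j, k, j\<close> produce the variables \<open>f, g, h\<close>. The monomial
  \<open>m\<close> collects the cancelled 2-cycles, and the third identity is obtained from the exchange
  relation \<open>f * h * m = B * g ^ \<beta> + A0 * D ^ \<beta>\<close> by substituting the first two and dividing by \<open>f\<close>.
\<close>

lemma three_mutations:
  fixes x :: "nat \<Rightarrow> 'a::field"
  assumes b: "skew b" and jk: "j < N" "k < N" "j \<noteq> k" and \<beta>: "b j k = int \<beta>"
  defines "R \<equiv> {..<N} - {j, k}"
  defines "b1 \<equiv> mut_mat j b"
  defines "b2 \<equiv> mut_mat k b1"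
  defines "x1 \<equiv> x(j := exch N b x j / x j)"
  defines "x2 \<equiv> x1(k := exch N b1 x1 k / x1 k)"
  defines "f \<equiv> x1 j" and "g \<equiv> x2 k" and "h \<equiv> exch N b2 x2 j / x2 j"
  defines "A0 \<equiv> (\<Prod>l\<in>R. x l ^ nat (b j l))" and "B \<equiv> (\<Prod>l\<in>R. x l ^ nat (- b j l))"
  defines "C \<equiv> (\<Prod>l\<in>R. x l ^ nat (b1 k l))" and "D \<equiv> (\<Prod>l\<in>R. x l ^ nat (- b1 k l))"
  defines "m \<equiv> (\<Prod>l\<in>R. x l ^ min (nat (- b j l)) (nat (b j l) + \<beta> * nat (- b1 k l)))"
  assumes nz: "x j \<noteq> 0" "x k \<noteq> 0" "f \<noteq> 0"
  shows "f * x j = A0 * x k ^ \<beta> + B"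
    and "g * x k = C * f ^ \<beta> + D"
    and "h * m * x k ^ \<beta> = x j * D ^ \<beta> +
      (if \<beta> = 0 then 0 else B * C * f ^ (\<beta> - 1) * (\<Sum>i<\<beta>. D ^ (\<beta> - Suc i) * (C * f ^ \<beta> + D) ^ i))"
proof -
  have bkj: "b k j = - int \<beta>" using skewD[OF b, of k j] \<beta> by simp
  show 1: "f * x j = A0 * x k ^ \<beta> + B"
    using nz skew_diag[OF b, of j] \<beta>
    by (simp add: f_def x1_def exch_split_two[OF jk] A0_def B_def R_def)
  have b1: "b1 k j = int \<beta>" "b1 j k = - int \<beta>" "b1 k k = 0" "b1 j l = - b j l" for l
    using bkj \<beta> jk skew_diag[OF skew_mut_mat[OF b], of j k] by (simp_all add: b1_def mut_mat_def)
  have x1R: "x1 l = x l" if "l \<in> R" for l using that by (simp add: x1_def R_def)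
  have "exch N b1 x1 k = C * f ^ \<beta> + D"
    using b1 jk by (simp add: exch_split_two[OF jk] C_def D_def f_def x1R R_def[symmetric])
  then show 2: "g * x k = C * f ^ \<beta> + D"
    using nz jk by (simp add: g_def x2_def x1_def)
  have x2R: "x2 l = x l" if "l \<in> R" for l using that x1R by (simp add: x2_def R_def)
  have b2: "b2 j k = int \<beta>" "b2 j j = 0"
    using b1 jk skew_diag[OF b, of j] by (simp_all add: b2_def mut_mat_def)
  have b2l: "b2 j l = - b j l - int \<beta> * max 0 (- b1 k l)" if "l \<in> R" for l
    using that b1 jk by (simp add: b2_def mut_mat_def R_def)
  define \<mu> where "\<mu> l = min (nat (- b j l)) (nat (b j l) + \<beta> * nat (- b1 k l))" for l
  \<comment> \<open>Up to the sign convention, \<open>b2 j l\<close> is the difference of the two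
    right-hand sides, and \<open>\<mu> l\<close> is their minimum; subtracting it leaves the
    positive and the negative part of \<open>b2 j l\<close>.\<close>
  have e1: "nat (b2 j l) + \<mu> l = nat (- b j l)"
    and e2: "nat (- b2 j l) + \<mu> l = nat (b j l) + \<beta> * nat (- b1 k l)" if "l \<in> R" for l
  proof -
    \<comment> \<open>Naming the product makes it an atom for linear arithmetic.\<close>
    define t where "t = \<beta> * nat (- b1 k l)"
    have "int \<beta> * max 0 (- b1 k l) = int t" by (simp add: t_def)
    with b2l[OF that] have "b2 j l = - b j l - int t" by simp
    then show "nat (b2 j l) + \<mu> l = nat (- b j l)"
      "nat (- b2 j l) + \<mu> l = nat (b j l) + \<beta> * nat (- b1 k l)"
      unfolding \<mu>_def t_def[symmetric] by linarith+
  qed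
  have m: "m = (\<Prod>l\<in>R. x l ^ \<mu> l)" by (simp add: m_def \<mu>_def)
  have q1: "x2 l ^ nat (b2 j l) * x l ^ \<mu> l = x l ^ nat (- b j l)" if "l \<in> R" for l
    unfolding x2R[OF that] power_add[symmetric] e1[OF that] ..
  have q2: "x2 l ^ nat (- b2 j l) * x l ^ \<mu> l = x l ^ nat (b j l) * (x l ^ nat (- b1 k l)) ^ \<beta>"
    if "l \<in> R" for l
    unfolding x2R[OF that] power_add[symmetric] e2[OF that] power_mult[symmetric]
    by (simp only: mult.commute)
  have p1: "(\<Prod>l\<in>R. x2 l ^ nat (b2 j l)) * m = B"
    unfolding m B_def prod.distrib[symmetric] by (rule prod.cong[OF refl q1])
  have p2: "(\<Prod>l\<in>R. x2 l ^ nat (- b2 j l)) * m = A0 * D ^ \<beta>"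
    unfolding m A0_def D_def prod_power_distrib prod.distrib[symmetric]
    by (rule prod.cong[OF refl q2])
  have x2: "x2 j = f" "x2 k = g" using jk by (simp_all add: x2_def f_def g_def)
  have "exch N b2 x2 j = g ^ \<beta> * (\<Prod>l\<in>R. x2 l ^ nat (b2 j l)) + (\<Prod>l\<in>R. x2 l ^ nat (- b2 j l))"
    using b2 x2 by (simp add: exch_split_two[OF jk] R_def[symmetric])
  then have "f * h = g ^ \<beta> * (\<Prod>l\<in>R. x2 l ^ nat (b2 j l)) + (\<Prod>l\<in>R. x2 l ^ nat (- b2 j l))"
    unfolding h_def x2 using nz(3) by simp
  then have "f * h * m = g ^ \<beta> * ((\<Prod>l\<in>R. x2 l ^ nat (b2 j l)) * m)
      + (\<Prod>l\<in>R. x2 l ^ nat (- b2 j l)) * m"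
    by (simp only: distrib_right mult.assoc)
  then have 3: "f * h * m = B * g ^ \<beta> + A0 * D ^ \<beta>"
    unfolding p1 p2 by (simp only: mult.commute)
  define P where "P = C * f ^ \<beta>"
  have "f * (h * m * x k ^ \<beta>) = (B * g ^ \<beta> + A0 * D ^ \<beta>) * x k ^ \<beta>"
    by (simp add: 3[symmetric] mult.assoc)
  also have "\<dots> = B * (g * x k) ^ \<beta> + (A0 * x k ^ \<beta>) * D ^ \<beta>"
    by (simp add: power_mult_distrib algebra_simps)
  also have "A0 * x k ^ \<beta> = f * x j - B" by (simp add: 1)
  also have "g * x k = P + D" by (simp add: 2 P_def)
  also have "B * (P + D) ^ \<beta> + (f * x j - B) * D ^ \<beta> = f * x j * D ^ \<beta> + B * ((P + D) ^ \<beta> - D ^ \<beta>)"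
    by (simp add: algebra_simps)
  also have "(P + D) ^ \<beta> - D ^ \<beta> = P * (\<Sum>i<\<beta>. D ^ (\<beta> - Suc i) * (P + D) ^ i)"
    by (simp add: power_diff_sumr2)
  finally have 4: "f * (h * m * x k ^ \<beta>) =
    f * x j * D ^ \<beta> + B * (P * (\<Sum>i<\<beta>. D ^ (\<beta> - Suc i) * (P + D) ^ i))" .
  show "h * m * x k ^ \<beta> = x j * D ^ \<beta> +
      (if \<beta> = 0 then 0 else B * C * f ^ (\<beta> - 1) * (\<Sum>i<\<beta>. D ^ (\<beta> - Suc i) * (C * f ^ \<beta> + D) ^ i))"
  proof (cases "\<beta> = 0")
    case True
    then show ?thesis using 4 nz by simp
  next
    case False
    \<comment> \<open>For positive \<open>\<beta>\<close> one factor \<open>f\<close> splits off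
      from \<open>P\<close>, so that both summands on the right become divisible by
      \<open>f\<close>.\<close>
    then have "P = f * (C * f ^ (\<beta> - 1))" by (cases \<beta>) (simp_all add: P_def)
    then have "f * (h * m * x k ^ \<beta>) = f * (x j * D ^ \<beta> +
      B * C * f ^ (\<beta> - 1) * (\<Sum>i<\<beta>. D ^ (\<beta> - Suc i) * (P + D) ^ i))"
      using 4 by (simp add: algebra_simps)
    then have "h * m * x k ^ \<beta> = x j * D ^ \<beta> +
      B * C * f ^ (\<beta> - 1) * (\<Sum>i<\<beta>. D ^ (\<beta> - Suc i) * (P + D) ^ i)"
      using nz by simp
    then show ?thesis using False by (simp add: P_def)
  qed
qed


section \<open>Regular elements in the Laurent polynomial ring\<close>

text \<open>The homogeneous component of degree \<open>e\<close> in the variable with index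
  \<open>N\<close>.\<close>

definition graded_part :: "nat \<Rightarrow> int \<Rightarrow> laurent \<Rightarrow> laurent" where
  "graded_part N e p = (\<Sum>a\<in>{a \<in> mkeys p. mlookup a N = e}. msingle a (mlookup p a))"

lemma lookup_graded_part: "mlookup (graded_part N e p) a = (if mlookup a N = e then mlookup p a else 0)"
  by (auto simp: graded_part_def lookup_sum lookup_single when_def sum.delta in_keys_iff)

lemma graded_part_add: "graded_part N e (p + q) = graded_part N e p + graded_part N e q"
  by (rule poly_mapping_eqI) (simp add: lookup_graded_part lookup_add)

lemma graded_part_eq_self:
  assumes "\<And>a. a \<in> mkeys p \<Longrightarrow> mlookup a N = e"
  shows "graded_part N e p = p"
  by (rule poly_mapping_eqI) (use assms in \<open>auto simp: lookup_graded_part in_keys_iff\<close>)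

lemma graded_part_eq_0:
  assumes "\<And>a. a \<in> mkeys p \<Longrightarrow> mlookup a N \<noteq> e"
  shows "graded_part N e p = 0"
  by (rule poly_mapping_eqI) (use assms in \<open>auto simp: lookup_graded_part in_keys_iff\<close>)

lemma keys_graded_part: "mkeys (graded_part N e p) = {a \<in> mkeys p. mlookup a N = e}"
  by (auto simp: in_keys_iff lookup_graded_part split: if_splits)

text \<open>A factor homogeneous of degree \<open>s\<close> shifts all degrees by \<open>s\<close>,
  so the part of \<open>p\<close> outside degree \<open>e\<close> cannot contribute.\<close>

lemma graded_part_mult:
  assumes g: "\<And>a. a \<in> mkeys g \<Longrightarrow> mlookup a N = s"
  shows "graded_part N (s + e) (g * p) = g * graded_part N e p"
proof -
  define r where "r = p - graded_part N e p"
  have r: "mlookup a N \<noteq> e" if "a \<in> mkeys r" for a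
    using that by (auto simp: r_def in_keys_iff lookup_minus lookup_graded_part)
  have "g * p = g * graded_part N e p + g * r" by (simp add: r_def algebra_simps)
  moreover have "graded_part N (s + e) (g * graded_part N e p) = g * graded_part N e p"
    by (rule graded_part_eq_self)
      (use g in \<open>auto simp: keys_graded_part lookup_add dest!: set_mp[OF keys_mult]\<close>)
  moreover have "graded_part N (s + e) (g * r) = 0"
    by (rule graded_part_eq_0) (use g r in \<open>auto simp: lookup_add dest!: set_mp[OF keys_mult]\<close>)
  ultimately show ?thesis by (simp add: graded_part_add)
qed

text \<open>Compare components of top degree in the variable \<open>N\<close>: \<open>f\<close> has
  degree 0 and \<open>R\<close> lies below \<open>T\<close>, so \<open>f\<close> divides
  \<open>T\<close> times the top component of \<open>q\<close>, hence that component,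
  \<open>T\<close> being a unit. Removing it from \<open>q\<close> leaves fewer degrees, and
  induction on their number applies.\<close>

lemma dvd_cancel_unit_leading_part:
  fixes f T R q :: laurent
  assumes f: "\<And>a. a \<in> mkeys f \<Longrightarrow> mlookup a N = 0"
    and T: "\<And>a. a \<in> mkeys T \<Longrightarrow> mlookup a N = s" "T dvd 1"
    and R: "\<And>a. a \<in> mkeys R \<Longrightarrow> mlookup a N < s"
    and dvd: "f dvd (T + R) * q"
  shows "f dvd q"
  using dvd
proof (induction "card ((\<lambda>a. mlookup a N) ` mkeys q)" arbitrary: q rule: less_induct)
  case less
  show ?case
  proof (cases "q = 0")
    case False
    define D where "D = (\<lambda>a. mlookup a N) ` mkeys q"
    have D: "finite D" "D \<noteq> {}" using False by (simp_all add: D_def)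
    define e where "e = Max D"
    define t where "t = graded_part N e q"
    have le: "mlookup a N \<le> e" if "a \<in> mkeys q" for a
      using that D unfolding e_def D_def by (intro Max_ge) auto
    have R0: "graded_part N (s + e) (R * q) = 0"
    proof (rule graded_part_eq_0)
      fix a assume "a \<in> mkeys (R * q)"
      then obtain u v where "a = u + v" "u \<in> mkeys R" "v \<in> mkeys q"
        using keys_mult[of R q] by blast
      then show "mlookup a N \<noteq> s + e" using R[of u] le[of v] by (simp add: lookup_add)
    qed
    have "graded_part N (s + e) ((T + R) * q) = T * t"
      using T R0 by (simp add: distrib_right graded_part_add graded_part_mult t_def)
    moreover obtain r where "(T + R) * q = f * r" using less.prems by (elim dvdE)
    moreover have "graded_part N (0 + (s + e)) (f * r) = f * graded_part N (s + e) r"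
      using f by (rule graded_part_mult)
    ultimately have "f dvd T * t" by simp
    moreover obtain T' where "T * T' = 1" using T(2) by (metis dvdE)
    then have "t = T * t * T'" by (simp add: ac_simps)
    ultimately have ft: "f dvd t" by (metis dvd_mult2)
    define q' where "q' = q - t"
    have "f dvd (T + R) * q'"
      using less.prems ft by (simp add: q'_def right_diff_distrib)
    moreover have "card ((\<lambda>a. mlookup a N) ` mkeys q') < card D"
    proof (rule psubset_card_mono[OF D(1)])
      have "(\<lambda>a. mlookup a N) ` mkeys q' \<subseteq> D - {e}"
        by (auto simp: q'_def t_def D_def in_keys_iff lookup_minus lookup_graded_part split: if_splits)
      then show "(\<lambda>a. mlookup a N) ` mkeys q' \<subset> D" using Max_in[OF D] by (auto simp: e_def)
    qed
    ultimately have "f dvd q'" using less.hyps by (simp add: D_def)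
    then show ?thesis using ft by (metis q'_def diff_add_cancel dvd_add)
  qed simp
qed

section \<open>Monomials and Laurent polynomials of bounded degree in one variable\<close>

definition unit_deg :: "nat \<Rightarrow> int \<Rightarrow> laurent fract set" where
  "unit_deg N e = {emb (msingle a 1) |a. mlookup a N = e}"

definition le_deg :: "nat \<Rightarrow> int \<Rightarrow> laurent fract set" where
  "le_deg N e = emb ` {p. \<forall>a\<in>mkeys p. mlookup a N \<le> e}"

definition zero_deg :: "nat \<Rightarrow> laurent fract set" where
  "zero_deg N = emb ` {p. \<forall>a\<in>mkeys p. mlookup a N = 0}"

lemma unit_deg_mult: "u \<in> unit_deg N d \<Longrightarrow> v \<in> unit_deg N e \<Longrightarrow> u * v \<in> unit_deg N (d + e)"
  unfolding unit_deg_def by (force simp: mult_single lookup_add simp flip: emb_mult)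

lemma unit_deg_one: "1 \<in> unit_deg N 0"
  unfolding unit_deg_def by (auto intro!: exI[of _ 0] simp: single_one)

lemma unit_deg_power: "u \<in> unit_deg N d \<Longrightarrow> u ^ i \<in> unit_deg N (int i * d)"
  by (induction i) (auto simp: unit_deg_one algebra_simps dest: unit_deg_mult)

lemma unit_deg_inverse: "u \<in> unit_deg N d \<Longrightarrow> inverse u \<in> unit_deg N (- d)"
proof -
  assume "u \<in> unit_deg N d"
  then obtain a where a: "u = emb (msingle a 1)" "mlookup a N = d" by (auto simp: unit_deg_def)
  have "u * emb (msingle (- a) 1) = 1" by (simp add: a mult_single flip: emb_mult)
  then have "inverse u = emb (msingle (- a) 1)" by (rule inverse_unique)
  then show ?thesis using a by (auto simp: unit_deg_def)
qed

lemma unit_deg_prod: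
  "(\<And>l. l \<in> B \<Longrightarrow> u l \<in> unit_deg N (d l)) \<Longrightarrow> (\<Prod>l\<in>B. u l) \<in> unit_deg N (\<Sum>l\<in>B. d l)"
  by (induction B rule: infinite_finite_induct) (auto simp: unit_deg_one intro: unit_deg_mult)

lemma unit_deg_range: "u \<in> unit_deg N d \<Longrightarrow> u \<in> range emb"
  by (auto simp: unit_deg_def)

lemma unit_deg_le: "u \<in> unit_deg N d \<Longrightarrow> d \<le> e \<Longrightarrow> u \<in> le_deg N e"
  unfolding unit_deg_def le_deg_def by force

lemma unit_deg_zero: "u \<in> unit_deg N 0 \<Longrightarrow> u \<in> zero_deg N"
  unfolding unit_deg_def zero_deg_def by force

lemma zero_deg_le: "u \<in> zero_deg N \<Longrightarrow> u \<in> le_deg N 0"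
  unfolding zero_deg_def le_deg_def by force

lemma le_deg_range: "u \<in> le_deg N d \<Longrightarrow> u \<in> range emb"
  by (auto simp: le_deg_def)

lemma le_deg_mono: "u \<in> le_deg N d \<Longrightarrow> d \<le> e \<Longrightarrow> u \<in> le_deg N e"
  unfolding le_deg_def by force

lemma le_deg_mult:
  assumes "u \<in> le_deg N d" "v \<in> le_deg N e" shows "u * v \<in> le_deg N (d + e)"
proof -
  obtain p q where pq: "u = emb p" "v = emb q"
    "\<forall>a\<in>mkeys p. mlookup a N \<le> d" "\<forall>a\<in>mkeys q. mlookup a N \<le> e"
    using assms by (auto simp: le_deg_def)
  have "mlookup a N \<le> d + e" if a: "a \<in> mkeys (p * q)" for a
  proof -
    obtain s t where "a = s + t" "s \<in> mkeys p" "t \<in> mkeys q"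
      using keys_mult[of p q] a by blast
    then show ?thesis using pq by (simp add: lookup_add add_mono)
  qed
  then show ?thesis using pq unfolding le_deg_def by (auto simp flip: emb_mult)
qed

lemma le_deg_add:
  assumes "u \<in> le_deg N d" "v \<in> le_deg N d" shows "u + v \<in> le_deg N d"
  using assms unfolding le_deg_def by (auto simp flip: emb_add dest!: set_mp[OF keys_add])

lemma le_deg_power: "u \<in> le_deg N d \<Longrightarrow> u ^ i \<in> le_deg N (int i * d)"
proof (induction i)
  case 0
  then show ?case using unit_deg_le[OF unit_deg_one, of 0 N] by simp
next
  case (Suc i)
  then have "u * u ^ i \<in> le_deg N (d + int i * d)" by (intro le_deg_mult) auto
  then show ?case by (simp add: algebra_simps)
qed

lemma le_deg_zero: "0 \<in> le_deg N d"
  unfolding le_deg_def by (auto intro!: image_eqI[of _ _ 0])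

lemma le_deg_sum: "(\<And>l. l \<in> B \<Longrightarrow> u l \<in> le_deg N d) \<Longrightarrow> (\<Sum>l\<in>B. u l) \<in> le_deg N d"
  by (induction B rule: infinite_finite_induct) (auto simp: le_deg_zero intro: le_deg_add)

lemma zero_deg_mult:
  assumes "u \<in> zero_deg N" "v \<in> zero_deg N" shows "u * v \<in> zero_deg N"
proof -
  obtain p q where pq: "u = emb p" "v = emb q"
    "\<forall>a\<in>mkeys p. mlookup a N = 0" "\<forall>a\<in>mkeys q. mlookup a N = 0"
    using assms by (auto simp: zero_deg_def)
  have "mlookup a N = 0" if a: "a \<in> mkeys (p * q)" for a
  proof -
    obtain s t where "a = s + t" "s \<in> mkeys p" "t \<in> mkeys q"
      using keys_mult[of p q] a by blast
    then show ?thesis using pq by (simp add: lookup_add)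
  qed
  then show ?thesis using pq unfolding zero_deg_def by (auto simp flip: emb_mult)
qed

lemma zero_deg_add:
  assumes "u \<in> zero_deg N" "v \<in> zero_deg N" shows "u + v \<in> zero_deg N"
  using assms unfolding zero_deg_def by (auto simp flip: emb_add dest!: set_mp[OF keys_add])

text \<open>For \<open>f\<close> in the image of \<open>emb\<close>: \<open>g\<close> is a
  nonzerodivisor modulo \<open>f\<close> in the embedded ring. Stating it inside the fraction field
  avoids pulling elements back.\<close>

definition regular_mod :: "'a::idom fract \<Rightarrow> 'a fract \<Rightarrow> bool" where
  "regular_mod f g \<longleftrightarrow> g \<in> range emb \<and>
    (\<forall>q\<in>range emb. \<forall>r\<in>range emb. g * q = f * r \<longrightarrow> (\<exists>r'\<in>range emb. q = f * r'))"

text \<open>The criterion used for \<open>g\<close> and \<open>h\<close>: \<open>f\<close> is free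
  of the variable \<open>N\<close>, and the leading part of the other element in that variable is an
  invertible monomial.\<close>

lemma regular_modI:
  assumes f: "f \<in> zero_deg N" and T: "T \<in> unit_deg N s" and R: "R \<in> le_deg N (s - 1)"
  shows "regular_mod f (T + R)"
proof -
  obtain f' where f': "f = emb f'" "\<And>a. a \<in> mkeys f' \<Longrightarrow> mlookup a N = 0"
    using f by (auto simp: zero_deg_def)
  obtain t where t: "T = emb (msingle t 1)" "mlookup t N = s" using T by (auto simp: unit_deg_def)
  obtain R' where R': "R = emb R'" "\<And>a. a \<in> mkeys R' \<Longrightarrow> mlookup a N < s"
    using R by (force simp: le_deg_def)
  have unit: "msingle t (1::int) dvd 1"
    by (rule dvdI[of _ _ "msingle (- t) 1"]) (simp add: mult_single)
  have key: "f' dvd q" if "f' dvd (msingle t 1 + R') * q" for q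
    by (rule dvd_cancel_unit_leading_part[OF f'(2) _ unit R'(2) that]) (use t in auto)
  show ?thesis
    unfolding regular_mod_def
  proof (intro conjI ballI impI)
    show "T + R \<in> range emb" by (simp add: t R' flip: emb_add)
    fix q r :: "laurent fract" assume "q \<in> range emb" "r \<in> range emb" and eq: "(T + R) * q = f * r"
    then obtain q' r' where qr: "q = emb q'" "r = emb r'" by blast
    have "(msingle t 1 + R') * q' = f' * r'"
      using eq by (simp add: qr t f' R' flip: emb_add emb_mult)
    then have "f' dvd q'" by (rule key[OF dvdI])
    then obtain w where "q' = f' * w" by (elim dvdE)
    then show "\<exists>r'\<in>range emb. q = f * r'" by (auto simp: qr f' emb_mult)
  qed
qed

lemma emb_range_mult:
  assumes "u \<in> range emb" "v \<in> range emb" shows "u * v \<in> range emb"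
proof -
  obtain p q where "u = emb p" "v = emb q" using assms by blast
  then show ?thesis by (simp flip: emb_mult)
qed

lemma emb_range_power: "u \<in> range emb \<Longrightarrow> u ^ i \<in> range emb"
  by (induction i) (auto intro: emb_range_mult range_eqI[of _ _ 1])

lemma regular_mod_mult: "regular_mod f g \<Longrightarrow> regular_mod f h \<Longrightarrow> regular_mod f (g * h)"
  unfolding regular_mod_def
proof (intro conjI ballI impI)
  fix q r
  assume g: "g \<in> range emb \<and>
     (\<forall>q\<in>range emb. \<forall>r\<in>range emb. g * q = f * r \<longrightarrow> (\<exists>r'\<in>range emb. q = f * r'))"
    and h: "h \<in> range emb \<and>
     (\<forall>q\<in>range emb. \<forall>r\<in>range emb. h * q = f * r \<longrightarrow> (\<exists>r'\<in>range emb. q = f * r'))"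
    and qr: "q \<in> range emb" "r \<in> range emb" "g * h * q = f * r"
  have hq: "h * q \<in> range emb" using h qr by (simp add: emb_range_mult)
  have "g * (h * q) = f * r" using qr by (simp add: mult.assoc)
  then obtain r' where "r' \<in> range emb" "h * q = f * r'" using g hq qr(2) by blast
  then show "\<exists>r'\<in>range emb. q = f * r'" using h qr(1) by blast
qed (auto intro: emb_range_mult)

lemma regular_mod_one: "regular_mod f 1"
  unfolding regular_mod_def by (auto intro: range_eqI[of _ _ 1])

lemma regular_mod_power: "regular_mod f g \<Longrightarrow> regular_mod f (g ^ i)"
  by (induction i) (auto intro: regular_mod_one regular_mod_mult)

text \<open>The exponent of \<open>f\<close> can be lowered one step at a time: \<open>g ^ t\<close>
  times \<open>u * f ^ Suc s\<close> is a multiple of \<open>f\<close>, so by regularity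
  \<open>u * f ^ Suc s\<close> already is one, and a factor \<open>f\<close> cancels.\<close>

lemma range_emb_of_regular:
  assumes f: "f \<in> range emb" "f \<noteq> 0" and g: "regular_mod f g"
    and u: "u * f ^ s \<in> range emb" "u * g ^ t \<in> range emb"
  shows "u \<in> range emb"
  using u(1)
proof (induction s)
  case (Suc s)
  have "g ^ t * (u * f ^ Suc s) = f * (u * g ^ t * f ^ s)" by (simp add: ac_simps)
  moreover have "u * g ^ t * f ^ s \<in> range emb"
    by (rule emb_range_mult[OF u(2) emb_range_power[OF f(1)]])
  ultimately obtain r where "r \<in> range emb" "u * f ^ Suc s = f * r"
    using regular_mod_power[OF g, of t] Suc.prems unfolding regular_mod_def by blast
  then have "u * f ^ s = r" using f(2) by (simp add: ac_simps)
  with \<open>r \<in> range emb\<close> show ?case by (intro Suc.IH) simp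
qed simp

text \<open>The elements whose denominator is a power of \<open>g\<close> form a ring, which
  contains the \<open>x i\<close> and their inverses.\<close>

lemma laurent_eval_localized:
  fixes x :: "nat \<Rightarrow> 'a::idom fract"
  assumes nz: "\<And>i. x i \<noteq> 0" and g: "g \<in> range emb"
    and x: "\<And>i. \<exists>s. x i * g ^ s \<in> range emb" "\<And>i. \<exists>s. inverse (x i) * g ^ s \<in> range emb"
  shows "\<exists>s. laurent_eval x p * g ^ s \<in> range emb"
proof -
  define A where "A = {u. \<exists>s. u * g ^ s \<in> range emb}"
  have "laurent_eval x p \<in> A"
  proof (rule laurent_eval_closed[OF nz])
    show "1 \<in> A" unfolding A_def by (auto intro!: exI[of _ 0] range_eqI[of _ _ 1])
    fix u v assume "u \<in> A" "v \<in> A"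
    then obtain s t where u: "u * g ^ s \<in> range emb" and v: "v * g ^ t \<in> range emb"
      unfolding A_def by blast
    have "(u - v) * g ^ (s + t) = u * g ^ s * g ^ t - v * g ^ t * g ^ s"
      by (simp add: power_add algebra_simps)
    also have "\<dots> \<in> range emb"
      using emb_range_mult[OF u emb_range_power[OF g, of t]] emb_range_mult[OF v emb_range_power[OF g, of s]]
      by (auto simp flip: emb_minus)
    finally show "u - v \<in> A" unfolding A_def by blast
    have "u * v * g ^ (s + t) = (u * g ^ s) * (v * g ^ t)" by (simp add: power_add ac_simps)
    also have "\<dots> \<in> range emb" using u v by (rule emb_range_mult)
    finally show "u * v \<in> A" unfolding A_def by blast
  qed (use x in \<open>simp_all add: A_def\<close>)
  then show ?thesis by (simp add: A_def)
qed


section \<open>The Laurent phenomenon for quivers\<close>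

definition var :: "nat \<Rightarrow> laurent" where
  "var i = msingle (msingle i 1) 1"

lemma gen_unit_deg: "emb (var i) \<in> unit_deg N (if i = N then 1 else 0)"
  by (auto simp: var_def unit_deg_def lookup_single when_def intro!: exI[of _ "msingle i 1"])

lemma inverse_gen_range: "inverse (emb (var i)) \<in> range emb"
  by (rule unit_deg_range[OF unit_deg_inverse[OF gen_unit_deg]])

definition laurent_pos :: "laurent fract set" where
  "laurent_pos = pos_quot (monoid_ring_eval.ev of_int (\<lambda>_. 1))"

lemma laurent_pos: "subtraction_free laurent_pos" "emb (var i) \<in> laurent_pos"
proof -
  interpret monoid_ring_eval "of_int :: int \<Rightarrow> complex" "\<lambda>_::nat \<Rightarrow>\<^sub>0 int. 1"
    by standard (simp_all add: mult.commute)
  show "subtraction_free laurent_pos"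
    unfolding laurent_pos_def by (rule pos_quot_subtraction_free) (simp_all add: ev_add ev_mult)
  show "emb (var i) \<in> laurent_pos"
  proof -
    have "\<exists>r>0. ev (var i) = complex_of_real r" "\<exists>r>0. ev 1 = complex_of_real r"
      by (intro exI[of _ 1], simp add: var_def ev_single)+
    then show ?thesis unfolding laurent_pos_def pos_quot_def emb_def by blast
  qed
qed

lemma emb_exch: "emb (exch N b u k) = exch N b (\<lambda>i. emb (u i)) k"
  by (simp add: exch_def emb_add emb_prod emb_power)

section \<open>Cluster variables as Laurent polynomials and their specialization\<close>

definition laurent_at :: "nat \<Rightarrow> (nat \<Rightarrow> nat \<Rightarrow> int) \<Rightarrow> nat list \<Rightarrow> bool" where
  "laurent_at N b ks \<longleftrightarrow> (\<forall>i. snd (fold (mut_seed N) ks (b, \<lambda>i. emb (var i))) i \<in> range emb)"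

text \<open>Meaningful only if \<open>laurent_at N b ks\<close>; otherwise \<open>inv emb\<close> is unspecified.\<close>

definition lpoly :: "nat \<Rightarrow> (nat \<Rightarrow> nat \<Rightarrow> int) \<Rightarrow> nat list \<Rightarrow> nat \<Rightarrow> laurent" where
  "lpoly N b ks i = inv emb (snd (fold (mut_seed N) ks (b, \<lambda>i. emb (var i))) i)"

lemma emb_lpoly:
  "laurent_at N b ks \<Longrightarrow> emb (lpoly N b ks i) = snd (fold (mut_seed N) ks (b, \<lambda>i. emb (var i))) i"
  unfolding laurent_at_def lpoly_def by (simp add: f_inv_into_f)

lemma laurent_at_Nil: "laurent_at N b []"
  by (simp add: laurent_at_def)

lemma lpoly_Nil: "lpoly N b [] i = var i"
  using emb_lpoly[OF laurent_at_Nil, of N b i] by simp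

lemma fold_snoc_mut_seed:
  "snd (fold (mut_seed N) (ks @ [k]) (b, x)) = (let y = snd (fold (mut_seed N) ks (b, x))
    in y(k := exch N (fold mut_mat ks b) y k / y k))"
  using fst_fold_mut_seed[of N ks b x]
  by (cases "fold (mut_seed N) ks (b, x)") (auto simp: Let_def)

text \<open>Positivity shows that the old variable is nonzero, so the division can be undone. What
  remains is an identity of Laurent polynomials, to which evaluations can be applied.\<close>

lemma lpoly_snoc:
  assumes "laurent_at N b ks" "laurent_at N b (ks @ [k])"
  shows "lpoly N b ks k * lpoly N b (ks @ [k]) k = exch N (fold mut_mat ks b) (lpoly N b ks) k"
    and "i \<noteq> k \<Longrightarrow> lpoly N b (ks @ [k]) i = lpoly N b ks i"
proof -
  define y where "y = snd (fold (mut_seed N) ks (b, \<lambda>i. emb (var i)))"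
  have y: "emb (lpoly N b ks i) = y i" for i using emb_lpoly[OF assms(1)] by (simp add: y_def)
  have y': "emb (lpoly N b (ks @ [k]) i) = (y(k := exch N (fold mut_mat ks b) y k / y k)) i" for i
    using emb_lpoly[OF assms(2)] by (simp only: fold_snoc_mut_seed y_def Let_def)
  have "y k \<in> laurent_pos"
    unfolding y_def by (rule fold_subtraction_free[OF laurent_pos])
  then have "y k \<noteq> 0" using subtraction_freeD(1)[OF laurent_pos(1)] by auto
  then have "emb (lpoly N b ks k * lpoly N b (ks @ [k]) k) = exch N (fold mut_mat ks b) y k"
    by (simp add: emb_mult y y')
  also have "\<dots> = emb (exch N (fold mut_mat ks b) (lpoly N b ks) k)"
    by (simp add: emb_exch y)
  finally show "lpoly N b ks k * lpoly N b (ks @ [k]) k = exch N (fold mut_mat ks b) (lpoly N b ks) k"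
    by simp
  show "lpoly N b (ks @ [k]) i = lpoly N b ks i" if "i \<noteq> k"
  proof -
    have "emb (lpoly N b (ks @ [k]) i) = emb (lpoly N b ks i)"
      using that by (simp add: y y')
    then show ?thesis by simp
  qed
qed

lemma laurent_eval_exch:
  assumes "\<And>i. x i \<noteq> (0::'a::field)"
  shows "laurent_eval x (exch N b u k) = exch N b (\<lambda>i. laurent_eval x (u i)) k"
proof -
  interpret monoid_ring_eval "of_int :: int \<Rightarrow> 'a" "monomial_value x"
    by (rule monoid_ring_eval_field) (rule assms)
  have "ev (\<Prod>l\<in>B. f l) = (\<Prod>l\<in>B. ev (f l))" for B :: "nat set" and f
    by (induction B rule: infinite_finite_induct) (simp_all add: ev_mult)
  then show ?thesis by (simp add: laurent_eval_def exch_def ev_add ev_power)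
qed

lemma laurent_eval_mult:
  assumes "\<And>i. x i \<noteq> (0::'a::field)"
  shows "laurent_eval x (p * q) = laurent_eval x p * laurent_eval x q"
  unfolding laurent_eval_def
  by (rule monoid_ring_eval.ev_mult[OF monoid_ring_eval_field]) (rule assms)

lemma laurent_eval_var:
  assumes "\<And>i. x i \<noteq> (0::'a::field)"
  shows "laurent_eval x (var i) = x i"
  unfolding laurent_eval_def var_def
  by (subst monoid_ring_eval.ev_single[OF monoid_ring_eval_field])
    (use assms in \<open>simp_all add: monomial_value_single\<close>)

text \<open>The exchange relations between Laurent polynomials survive evaluation at
  \<open>x\<close>, and membership in \<open>P\<close> keeps the divisors nonzero, so both sides
  obey the same recursion. All prefixes must be Laurent because every intermediate
  \<open>lpoly\<close> enters a relation.\<close>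

lemma mut_seeds_specialize:
  assumes P: "subtraction_free P" "\<And>i. x i \<in> P"
    and "\<And>us vs. ks = us @ vs \<Longrightarrow> laurent_at N b us"
  shows "snd (fold (mut_seed N) ks (b, x)) i = laurent_eval x (lpoly N b ks i)"
  using assms(3)
proof (induction ks arbitrary: i rule: rev_induct)
  have nz: "x i \<noteq> 0" for i using P subtraction_freeD(1)[OF P(1)] by metis
  {
    case Nil
    show ?case by (simp add: lpoly_Nil laurent_eval_var[OF nz])
  next
    case (snoc k ks)
    have at: "laurent_at N b ks" "laurent_at N b (ks @ [k])"
      using snoc.prems[of ks "[k]"] snoc.prems[of "ks @ [k]" "[]"] by simp_all
    define y where "y = snd (fold (mut_seed N) ks (b, x))"
    have y: "y i = laurent_eval x (lpoly N b ks i)" for i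
      unfolding y_def by (rule snoc.IH) (use snoc.prems in auto)
    have "y k \<in> P" unfolding y_def by (rule fold_subtraction_free[OF P])
    then have yk: "y k \<noteq> 0" using subtraction_freeD(1)[OF P(1)] by auto
    have "y k * laurent_eval x (lpoly N b (ks @ [k]) k) = exch N (fold mut_mat ks b) y k"
      using arg_cong[OF lpoly_snoc(1)[OF at], of "laurent_eval x"]
      by (simp add: laurent_eval_mult[OF nz] laurent_eval_exch[OF nz] flip: y)
    then have "laurent_eval x (lpoly N b (ks @ [k]) k) = exch N (fold mut_mat ks b) y k / y k"
      using yk by (simp add: field_simps)
    then show ?case
      by (simp only: fold_snoc_mut_seed Let_def flip: y_def)
        (simp add: y lpoly_snoc(2)[OF at])
  }
qed

section \<open>Framing by one frozen vertex and the induction\<close>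

text \<open>
  The vertex \<open>N\<close> is frozen and attached to \<open>k\<close> only. Its variable does not occur in \<open>f\<close>, while the
  leading coefficients of \<open>g\<close> and \<open>h\<close> with respect to it are monomials, so that \<open>g\<close> and \<open>h\<close> are
  regular modulo \<open>f\<close> even if \<open>f\<close> and \<open>g\<close> have a common factor without the extra vertex.
\<close>

definition frame :: "nat \<Rightarrow> nat \<Rightarrow> (nat \<Rightarrow> nat \<Rightarrow> int) \<Rightarrow> nat \<Rightarrow> nat \<Rightarrow> int" where
  "frame N k b i j = (if i = N then if j = k then 1 else 0
     else if j = N then if i = k then - 1 else 0 else b i j)"

lemma skew_frame:
  assumes "skew b" "k \<noteq> N" shows "skew (frame N k b)"
  unfolding skew_def
proof (intro allI)
  fix i j
  have "b i j = - b j i" by (rule skewD[OF assms(1)])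
  then show "frame N k b i j = - frame N k b j i" using assms(2) by (auto simp: frame_def)
qed

text \<open>A frozen variable equal to 1 contributes trivial factors to the exchange polynomials.
  Since no mutation is at \<open>N\<close>, the entries at \<open>N\<close> never influence those
  between other vertices.\<close>

lemma fold_frozen_one:
  assumes "set ks \<subseteq> {..<N}" "\<And>i j. i \<noteq> N \<Longrightarrow> j \<noteq> N \<Longrightarrow> c i j = b i j"
    "\<And>i. i \<noteq> N \<Longrightarrow> y i = x i" "y N = (1::'a::field)" "i \<noteq> N"
  shows "snd (fold (mut_seed (Suc N)) ks (c, y)) i = snd (fold (mut_seed N) ks (b, x)) i"
  using assms
proof (induction ks arbitrary: b c x y)
  case (Cons k ks)
  have k: "k < N" using Cons.prems by simp
  have "exch (Suc N) c y k = exch N b y k"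
    using Cons.prems k by (simp add: exch_def)
  also have "\<dots> = exch N b x k"
    by (rule exch_cong) (use Cons.prems in auto)
  finally have e: "exch (Suc N) c y k = exch N b x k" .
  have "snd (fold (mut_seed (Suc N)) ks (mut_mat k c, y(k := exch (Suc N) c y k / y k))) i =
    snd (fold (mut_seed N) ks (mut_mat k b, x(k := exch N b x k / x k))) i"
    by (rule Cons.IH) (use Cons.prems k in \<open>auto simp: mut_mat_def e\<close>)
  then show ?case by simp
qed simp

lemma fold_untouched: "i \<notin> set ks \<Longrightarrow> snd (fold (mut_seed N) ks (b, x)) i = x i"
proof (induction ks arbitrary: b x)
  case (Cons k ks)
  have "snd (fold (mut_seed N) ks (mut_mat k b, x(k := exch N b x k / x k))) i =
    (x(k := exch N b x k / x k)) i"
    by (rule Cons.IH) (use Cons.prems in simp)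
  then show ?case using Cons.prems by simp
qed simp

lemma monomial_unit_deg:
  assumes "finite R" "N \<in> R"
  shows "(\<Prod>l\<in>R. emb (var l) ^ e l) \<in> unit_deg N (int (e N))"
proof -
  have "(\<Prod>l\<in>R. emb (var l) ^ e l) \<in> unit_deg N (\<Sum>l\<in>R. int (e l) * (if l = N then 1 else 0))"
    by (rule unit_deg_prod) (rule unit_deg_power[OF gen_unit_deg])
  also have "(\<Sum>l\<in>R. int (e l) * (if l = N then 1 else 0)) = (\<Sum>l\<in>R. if l = N then int (e l) else 0)"
    by (rule sum.cong) auto
  also have "\<dots> = int (e N)" using assms by simp
  finally show ?thesis .
qed

lemma laurent_at_framed:
  assumes IH: "\<And>M b us. length us < Suc (Suc (length ks)) \<Longrightarrow> skew b \<Longrightarrow> set us \<subseteq> {..<M} \<Longrightarrow>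
      laurent_at M b us"
    and b: "skew b" and ks: "set (j # k # ks) \<subseteq> {..<N}" and jk: "j \<noteq> k" "b j k = int \<beta>"
  shows "laurent_at (Suc N) (frame N k b) (j # k # ks)"
  unfolding laurent_at_def
proof
  fix i
  define M where "M = Suc N"
  define c where "c = frame N k b"
  have lt: "j < M" "k < M" "j < N" "k < N" using ks by (auto simp: M_def)
  have c: "skew c" unfolding c_def by (rule skew_frame[OF b]) (use lt in simp)
  have cjk: "c j k = int \<beta>" using jk lt by (simp add: c_def frame_def)
  define x :: "nat \<Rightarrow> laurent fract" where "x = (\<lambda>i. emb (var i))"
  define c1 where "c1 = mut_mat j c"
  define c2 where "c2 = mut_mat k c1"
  define c3 where "c3 = mut_mat j c2"
  define x1 where "x1 = x(j := exch M c x j / x j)"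
  define x2 where "x2 = x1(k := exch M c1 x1 k / x1 k)"
  define x3 where "x3 = x2(j := exch M c2 x2 j / x2 j)"
  note P = laurent_pos(1)
  have nzP: "u \<noteq> 0" if "u \<in> laurent_pos" for u
    using that subtraction_freeD(1)[OF P] by auto
  have xP: "x i \<in> laurent_pos" for i by (simp add: x_def laurent_pos)
  have x1P: "x1 i \<in> laurent_pos" for i
    unfolding x1_def using xP exch_subtraction_free[OF P xP] by (auto intro: subtraction_freeD(5)[OF P])
  have x2P: "x2 i \<in> laurent_pos" for i
    unfolding x2_def using x1P exch_subtraction_free[OF P x1P] by (auto intro: subtraction_freeD(5)[OF P])
  have x3P: "x3 i \<in> laurent_pos" for i
    unfolding x3_def using x2P exch_subtraction_free[OF P x2P] by (auto intro: subtraction_freeD(5)[OF P])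
  define u where "u = snd (fold (mut_seed M) ks (c2, x2)) i"
  have seed1: "mut_seed M j (c, x) = (c1, x1)" by (simp add: c1_def x1_def)
  have seed2: "mut_seed M k (c1, x1) = (c2, x2)" by (simp add: c2_def x2_def)
  have seed3: "mut_seed M j (c2, x2) = (c3, x3)" by (simp add: c3_def x3_def)
  have skews: "skew c1" "skew c2" "skew c3" using c by (simp_all add: c1_def c2_def c3_def skew_mut_mat)
  have seed4: "mut_seed M j (c3, x3) = (c2, x2)"
    unfolding seed3[symmetric]
    by (rule mut_seed_invol[OF skews(2) nzP[OF x2P] nzP[OF exch_subtraction_free[OF P x2P]]])
  have sub: "set us \<subseteq> {..<M}" if "set us \<subseteq> set (j # k # ks)" for us
    using that ks by (force simp: M_def)
  have u1: "u = laurent_eval x1 (lpoly M c1 (k # ks) i)"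
  proof -
    have "snd (fold (mut_seed M) (k # ks) (c1, x1)) i = laurent_eval x1 (lpoly M c1 (k # ks) i)"
    proof (rule mut_seeds_specialize[OF P x1P])
      fix us vs assume us: "k # ks = us @ vs"
      have "length us \<le> length (k # ks)" "set us \<subseteq> set (k # ks)" unfolding us by auto
      then show "laurent_at M c1 us" by (intro IH skews sub) auto
    qed
    then show ?thesis by (simp only: fold_simps seed2 u_def)
  qed
  have u3: "u = laurent_eval x3 (lpoly M c3 (j # ks) i)"
  proof -
    have "snd (fold (mut_seed M) (j # ks) (c3, x3)) i = laurent_eval x3 (lpoly M c3 (j # ks) i)"
    proof (rule mut_seeds_specialize[OF P x3P])
      fix us vs assume us: "j # ks = us @ vs"
      have "length us \<le> length (j # ks)" "set us \<subseteq> set (j # ks)" unfolding us by auto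
      then show "laurent_at M c3 us" by (intro IH skews sub) auto
    qed
    then show ?thesis by (simp only: fold_simps seed4 u_def)
  qed
  define f where "f = x1 j"
  define g where "g = x2 k"
  define h where "h = x3 j"
  define R where "R = {..<M} - {j, k}"
  define A0 where "A0 = (\<Prod>l\<in>R. x l ^ nat (c j l))"
  define B where "B = (\<Prod>l\<in>R. x l ^ nat (- c j l))"
  define C where "C = (\<Prod>l\<in>R. x l ^ nat (c1 k l))"
  define D where "D = (\<Prod>l\<in>R. x l ^ nat (- c1 k l))"
  define m where "m = (\<Prod>l\<in>R. x l ^ min (nat (- c j l)) (nat (c j l) + \<beta> * nat (- c1 k l)))"
  have f0: "f \<noteq> 0" unfolding f_def by (rule nzP[OF x1P])
  have rels: "f * x j = A0 * x k ^ \<beta> + B" "g * x k = C * f ^ \<beta> + D"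
    "h * m * x k ^ \<beta> = x j * D ^ \<beta> +
      (if \<beta> = 0 then 0 else B * C * f ^ (\<beta> - 1) * (\<Sum>i<\<beta>. D ^ (\<beta> - Suc i) * (C * f ^ \<beta> + D) ^ i))"
    using three_mutations[OF c lt(1,2) jk(1) cjk, of x, folded c1_def, folded c2_def, folded x1_def,
        folded x2_def, folded f_def R_def, folded g_def, folded A0_def B_def C_def D_def m_def]
      f0 nzP[OF xP] by (simp_all add: h_def x3_def)
  have R: "finite R" "N \<in> R" using lt by (auto simp: R_def M_def)
  have cN: "c j N = 0" "c1 k N = - 1"
    using jk lt by (simp_all add: c1_def c_def mut_mat_def frame_def)
  have deg: "A0 \<in> unit_deg N 0" "B \<in> unit_deg N 0" "C \<in> unit_deg N 0" "D \<in> unit_deg N 1" "m \<in> unit_deg N 0"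
    using monomial_unit_deg[OF R, of "\<lambda>l. nat (c j l)"] monomial_unit_deg[OF R, of "\<lambda>l. nat (- c j l)"]
      monomial_unit_deg[OF R, of "\<lambda>l. nat (c1 k l)"] monomial_unit_deg[OF R, of "\<lambda>l. nat (- c1 k l)"]
      monomial_unit_deg[OF R, of "\<lambda>l. min (nat (- c j l)) (nat (c j l) + \<beta> * nat (- c1 k l))"]
    by (simp_all add: cN A0_def B_def C_def D_def m_def x_def)
  have degx: "x j \<in> unit_deg N 0" "x k \<in> unit_deg N 0"
    using gen_unit_deg[of j N] gen_unit_deg[of k N] lt by (simp_all add: x_def)
  have xk\<beta>: "x k ^ \<beta> \<in> unit_deg N 0" using unit_deg_power[OF degx(2), of \<beta>] by simp
  have "A0 * x k ^ \<beta> + B \<in> zero_deg N"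
    using unit_deg_mult[OF deg(1) xk\<beta>] deg(2) by (auto intro: zero_deg_add unit_deg_zero)
  moreover have "f = (A0 * x k ^ \<beta> + B) * inverse (x j)"
    using rels(1) nzP[OF xP, of j] by (simp add: field_simps)
  ultimately have fz: "f \<in> zero_deg N"
    using unit_deg_inverse[OF degx(1)] by (auto intro: zero_deg_mult unit_deg_zero)
  have fpow: "f ^ i \<in> le_deg N 0" for i
    using le_deg_power[OF zero_deg_le[OF fz], of i] by simp
  have Cf: "C * f ^ \<beta> \<in> le_deg N 0"
    using le_deg_mult[OF unit_deg_le[OF deg(3) order_refl] fpow] by simp
  have reg_g: "regular_mod f g"
  proof -
    have "g = inverse (x k) * D + inverse (x k) * (C * f ^ \<beta>)"
      using rels(2) nzP[OF xP, of k] by (simp add: field_simps)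
    moreover have "inverse (x k) * D \<in> unit_deg N 1"
      using unit_deg_mult[OF unit_deg_inverse[OF degx(2)] deg(4)] by simp
    moreover have "inverse (x k) * (C * f ^ \<beta>) \<in> le_deg N (1 - 1)"
      using le_deg_mult[OF unit_deg_le[OF unit_deg_inverse[OF degx(2)] order_refl] Cf] by simp
    ultimately show ?thesis using regular_modI[OF fz] by metis
  qed
  \<comment> \<open>After division by the monomial \<open>m * x k ^ \<beta>\<close>, the term with
    \<open>D ^ \<beta>\<close> is a monomial of degree \<open>\<beta>\<close>. Each remaining
    summand has only \<open>\<beta> - 1\<close> factors of degree at most 1.\<close>
  have reg_h: "regular_mod f h"
  proof -
    define S where "S = (if \<beta> = 0 then 0 else B * C * f ^ (\<beta> - 1) *
      (\<Sum>i<\<beta>. D ^ (\<beta> - Suc i) * (C * f ^ \<beta> + D) ^ i))"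
    define w where "w = inverse (m * x k ^ \<beta>)"
    have m0: "m \<noteq> 0" using nzP[OF xP] R(1) by (simp add: m_def)
    have w: "w \<in> unit_deg N 0"
      using unit_deg_inverse[OF unit_deg_mult[OF deg(5) xk\<beta>]] by (simp add: w_def)
    have "h = w * (h * m * x k ^ \<beta>)" using m0 nzP[OF xP, of k] by (simp add: w_def field_simps)
    also have "\<dots> = w * (x j * D ^ \<beta>) + w * S" unfolding rels(3) S_def by (simp only: distrib_left)
    finally have h: "h = w * (x j * D ^ \<beta>) + w * S" .
    have "w * (x j * D ^ \<beta>) \<in> unit_deg N (int \<beta>)"
      using unit_deg_mult[OF w unit_deg_mult[OF degx(1) unit_deg_power[OF deg(4), of \<beta>]]] by simp
    moreover have "w * S \<in> le_deg N (int \<beta> - 1)"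
    proof (cases "\<beta> = 0")
      \<comment> \<open>Here \<open>h\<close> is itself an invertible monomial, and the remainder 0
        lies in every \<open>le_deg\<close> set, even for degree -1.\<close>
      case True
      then show ?thesis by (simp add: S_def le_deg_zero)
    next
      case False
      have CD: "C * f ^ \<beta> + D \<in> le_deg N 1"
        using le_deg_mono[OF Cf, of 1] unit_deg_le[OF deg(4) order_refl] by (auto intro: le_deg_add)
      have "D ^ (\<beta> - Suc i) * (C * f ^ \<beta> + D) ^ i \<in> le_deg N (int \<beta> - 1)" if "i < \<beta>" for i
      proof -
        have "D ^ (\<beta> - Suc i) * (C * f ^ \<beta> + D) ^ i \<in> le_deg N (int (\<beta> - Suc i) * 1 + int i * 1)"
          by (intro le_deg_mult le_deg_power CD unit_deg_le[OF deg(4) order_refl])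
        also have "int (\<beta> - Suc i) * 1 + int i * 1 = int \<beta> - 1" using that by simp
        finally show ?thesis .
      qed
      then have "(\<Sum>i<\<beta>. D ^ (\<beta> - Suc i) * (C * f ^ \<beta> + D) ^ i) \<in> le_deg N (int \<beta> - 1)"
        by (intro le_deg_sum) simp
      then have "w * (B * C * f ^ (\<beta> - 1) * (\<Sum>i<\<beta>. D ^ (\<beta> - Suc i) * (C * f ^ \<beta> + D) ^ i))
          \<in> le_deg N (0 + (0 + 0 + 0 + (int \<beta> - 1)))"
        by (intro le_deg_mult fpow unit_deg_le[OF w order_refl] unit_deg_le[OF deg(2) order_refl]
            unit_deg_le[OF deg(3) order_refl])
      then show ?thesis using False by (simp add: S_def)
    qed
    ultimately show ?thesis unfolding h by (rule regular_modI[OF fz])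
  qed
  have reg: "regular_mod f (g * h)" by (rule regular_mod_mult[OF reg_g reg_h])
  have rng: "f \<in> range emb" "g \<in> range emb" "h \<in> range emb"
    using le_deg_range[OF zero_deg_le[OF fz]] reg_g reg_h by (simp_all add: regular_mod_def)
  have one: "1 \<in> range (emb :: laurent \<Rightarrow> _)" by (auto intro: range_eqI[of _ _ 1])
  have xr: "x i \<in> range emb" "inverse (x i) \<in> range emb" for i
    by (simp_all add: x_def inverse_gen_range)
  have loc: "\<exists>s. v * w ^ s \<in> range emb" if "v \<in> range emb" for v w :: "laurent fract"
    using that by (intro exI[of _ 0]) simp
  \<comment> \<open>The only variable of this seed that is not initial is \<open>f\<close>, so only
    its inverse requires a denominator.\<close>
  have "\<exists>s. u * f ^ s \<in> range emb"
    unfolding u1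
  proof (rule laurent_eval_localized[OF nzP[OF x1P] rng(1)])
    fix l
    show "\<exists>s. x1 l * f ^ s \<in> range emb"
      using xr rng(1) by (intro loc) (cases "l = j"; simp add: x1_def f_def)
    show "\<exists>s. inverse (x1 l) * f ^ s \<in> range emb"
    proof (cases "l = j")
      case True
      then show ?thesis using f0 one by (auto simp: f_def intro!: exI[of _ 1])
    qed (use xr in \<open>auto simp: x1_def intro!: loc\<close>)
  qed
  \<comment> \<open>Here \<open>g\<close> and \<open>h\<close> are the new variables; the inverse of
    either one times \<open>g * h\<close> is the other one.\<close>
  moreover have "\<exists>s. u * (g * h) ^ s \<in> range emb"
    unfolding u3
  proof (rule laurent_eval_localized[OF nzP[OF x3P]])
    show "g * h \<in> range emb" by (rule emb_range_mult[OF rng(2,3)])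
    fix l
    have x3: "x3 l = (if l = j then h else if l = k then g else x l)"
      using jk by (simp add: h_def g_def x3_def x2_def x1_def)
    show "\<exists>s. x3 l * (g * h) ^ s \<in> range emb"
      using xr rng by (intro loc) (simp add: x3)
    have gh: "g \<noteq> 0" "h \<noteq> 0" using nzP[OF x2P] nzP[OF x3P] by (simp_all add: g_def h_def)
    consider "l = j" | "l = k" "l \<noteq> j" | "l \<noteq> j" "l \<noteq> k" by blast
    then show "\<exists>s. inverse (x3 l) * (g * h) ^ s \<in> range emb"
    proof cases
      case 1
      then have "inverse (x3 l) * (g * h) ^ 1 = g" using gh x3 by simp
      then show ?thesis using rng by metis
    next
      case 2
      then have "inverse (x3 l) * (g * h) ^ 1 = h" using gh x3 by simp
      then show ?thesis using rng by metis
    next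
      case 3
      then show ?thesis using xr by (intro loc) (simp add: x3)
    qed
  qed
  ultimately have "u \<in> range emb"
    using range_emb_of_regular[OF rng(1) f0 reg] by blast
  then have "snd (fold (mut_seed M) (j # k # ks) (c, x)) i \<in> range emb"
    by (simp only: fold_simps seed1 seed2 u_def)
  then show "snd (fold (mut_seed (Suc N)) (j # k # ks) (frame N k b, \<lambda>i. emb (var i))) i \<in> range emb"
    unfolding M_def c_def x_def .
qed

lemma laurent_at_uminus: "laurent_at N (\<lambda>i j. - b i j) ks = laurent_at N b ks"
  by (simp add: laurent_at_def fold_mut_seed_uminus split: prod.splits)

text \<open>Strong induction on the length, for all ranks at once because framing raises the rank. A
  single mutation divides by a variable and a repeated direction cancels; otherwise the framed
  quiver is used and its frozen variable specialized to 1.\<close>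

theorem laurent_phenomenon:
  assumes "skew b" "set ks \<subseteq> {..<N}"
  shows "laurent_at N b ks"
  using assms
proof (induction ks arbitrary: N b rule: length_induct)
  case (1 ks)
  have IH: "laurent_at M b us" if "length us < length ks" "skew b" "set us \<subseteq> {..<M}" for M b us
    using 1(1) that by blast
  have nz: "u \<noteq> 0" if "u \<in> laurent_pos" for u
    using that subtraction_freeD(1)[OF laurent_pos(1)] by auto
  consider "ks = []" | j where "ks = [j]" | j ks' where "ks = j # j # ks'"
    | j k ks' where "ks = j # k # ks'" "j \<noteq> k"
    by (metis list.exhaust)
  then show ?case
  proof cases
    case 1
    then show ?thesis by (simp add: laurent_at_Nil)
  next
    case (2 j)
    have "exch N b (\<lambda>i. emb (var i)) j / emb (var j) \<in> range emb"
      unfolding divide_inverse emb_exch[symmetric]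
      by (rule emb_range_mult[OF rangeI inverse_gen_range])
    then show ?thesis by (simp add: laurent_at_def 2)
  next
    case (3 j ks')
    have "laurent_at N b ks'" by (rule IH) (use 3 1 in auto)
    moreover have "mut_seed N j (mut_seed N j (b, \<lambda>i. emb (var i))) = (b, \<lambda>i. emb (var i))"
      by (rule mut_seed_invol[OF \<open>skew b\<close> nz[OF laurent_pos(2)]
            nz[OF exch_subtraction_free[OF laurent_pos]]])
    ultimately show ?thesis unfolding laurent_at_def 3 by (simp only: fold_simps simp_thms)
  next
    case (4 j k ks')
    \<comment> \<open>Stated for every matrix with this sign, so that it also applies to the quiver
      with all arrows reversed.\<close>
    have pos: "laurent_at N b ks" if b: "skew b" and bjk: "b j k \<ge> 0" for b
      unfolding laurent_at_def
    proof
      fix i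
      define c where "c = frame N k b"
      have k: "k < N" "set ks \<subseteq> {..<N}" using 4 1 by auto
      have c: "skew c" unfolding c_def by (rule skew_frame[OF b]) (use k in simp)
      have full: "laurent_at (Suc N) c ks"
        unfolding c_def 4
        by (rule laurent_at_framed[where \<beta> = "nat (b j k)"]) (use IH b bjk 1 4 in auto)
      define x :: "nat \<Rightarrow> laurent fract" where "x = (\<lambda>i. emb (var i))"
      have xP: "(x(N := 1)) i \<in> laurent_pos" for i
        using laurent_pos subtraction_freeD(2)[OF laurent_pos(1)] by (simp add: x_def)
      have "snd (fold (mut_seed (Suc N)) ks (c, x(N := 1))) i =
        laurent_eval (x(N := 1)) (lpoly (Suc N) c ks i)"
      proof (rule mut_seeds_specialize[OF laurent_pos(1) xP])
        fix us vs assume us: "ks = us @ vs"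
        \<comment> \<open>The whole list is covered by \<open>full\<close>, proper prefixes by the
          induction hypothesis.\<close>
        show "laurent_at (Suc N) c us"
        proof (cases "vs = []")
          case True
          then show ?thesis using full us by simp
        next
          case False
          then show ?thesis using us k by (intro IH c) auto
        qed
      qed
      also have "\<dots> \<in> range emb"
      proof (rule laurent_eval_closed[OF nz[OF xP]])
        show one: "1 \<in> range (emb :: laurent \<Rightarrow> _)" by (auto intro: range_eqI[of _ _ 1])
        fix l
        show "(x(N := 1)) l \<in> range emb" "inverse ((x(N := 1)) l) \<in> range emb"
          using one by (auto simp: x_def inverse_gen_range)
      qed (auto intro: emb_range_mult simp flip: emb_minus)
      finally have *: "snd (fold (mut_seed (Suc N)) ks (c, x(N := 1))) i \<in> range emb" .
      show "snd (fold (mut_seed N) ks (b, \<lambda>i. emb (var i))) i \<in> range emb"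
      proof (cases "i = N")
        case True
        then have "i \<notin> set ks" using k by auto
        then show ?thesis by (simp add: fold_untouched)
      next
        case False
        have "snd (fold (mut_seed (Suc N)) ks (c, x(N := 1))) i = snd (fold (mut_seed N) ks (b, x)) i"
          by (rule fold_frozen_one) (use k False in \<open>auto simp: c_def frame_def\<close>)
        then show ?thesis using * by (simp add: x_def)
      qed
    qed
    show ?thesis
    proof (cases "b j k \<ge> 0")
      case True
      then show ?thesis using pos 1 by blast
    next
      case False
      have "skew (\<lambda>i j. - b i j)"
        unfolding skew_def using skewD[OF \<open>skew b\<close>] by (metis minus_minus)
      then have "laurent_at N (\<lambda>i j. - b i j) ks" using False by (intro pos) auto
      then show ?thesis by (simp only: laurent_at_uminus)
    qed
  qed
qed


section \<open>Products of the factors \<open>1 + \<xi> i * \<xi> j\<close>\<close>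

text \<open>Moving one pair past the other takes four transpositions, so the signs cancel.\<close>

lemma \<xi>_pair_commute:
  "\<xi> i * \<xi> j * (\<xi> k * \<xi> l) = \<xi> k * \<xi> l * (\<xi> i * \<xi> j :: 'a::comm_ring_1 grassmann)"
proof -
  have swap: "u * \<xi> a * \<xi> b * v = - (u * \<xi> b * \<xi> a * v :: 'a grassmann)" for u v a b
  proof -
    have "u * \<xi> a * \<xi> b * v = u * (\<xi> a * \<xi> b) * v" by (simp only: mult.assoc)
    also have "\<xi> a * \<xi> b = - (\<xi> b * \<xi> a :: 'a grassmann)" by (rule \<xi>_anticommute)
    finally show ?thesis by (simp add: mult.assoc)
  qed
  have "\<xi> i * \<xi> j * (\<xi> k * \<xi> l) = \<xi> i * \<xi> j * \<xi> k * (\<xi> l :: 'a grassmann)"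
    by (simp add: mult.assoc)
  also have "\<dots> = - (\<xi> i * \<xi> k * \<xi> j * \<xi> l)" by (rule swap)
  also have "\<dots> = \<xi> k * \<xi> i * \<xi> j * \<xi> l" using swap[of 1 i k "\<xi> j * \<xi> l"] by (simp add: mult.assoc)
  also have "\<dots> = - (\<xi> k * \<xi> i * \<xi> l * \<xi> j)" using swap[of "\<xi> k * \<xi> i" j l 1] by simp
  also have "\<dots> = \<xi> k * \<xi> l * \<xi> i * \<xi> j" using swap[of "\<xi> k" i l "\<xi> j"] by simp
  finally show ?thesis by (simp add: mult.assoc)
qed

lemma \<xi>_pair_square: "\<xi> i * \<xi> j * (\<xi> i * \<xi> j) = (0 :: 'a::comm_ring_1 grassmann)"
proof -
  have "\<xi> i * \<xi> j * (\<xi> i * \<xi> j) = \<xi> i * (\<xi> j * \<xi> i) * (\<xi> j :: 'a grassmann)"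
    by (simp add: mult.assoc)
  also have "\<xi> j * \<xi> i = - (\<xi> i * \<xi> j :: 'a grassmann)" by (rule \<xi>_anticommute)
  also have "\<xi> i * - (\<xi> i * \<xi> j) * \<xi> j = - (\<xi> i * \<xi> i * \<xi> j * (\<xi> j :: 'a grassmann))"
    by (simp add: mult.assoc)
  finally show ?thesis by (simp add: \<xi>_square)
qed

text \<open>The power of \<open>1 + \<xi> i * \<xi> j\<close> with integer exponent
  \<open>c\<close>: it is linear in \<open>c\<close> because the pair squares to 0. Negative
  exponents provide the inverses.\<close>

definition pair_factor :: "int \<Rightarrow> nat \<Rightarrow> nat \<Rightarrow> 'a::comm_ring_1 grassmann" where
  "pair_factor c i j = 1 + of_int c * (\<xi> i * \<xi> j)"

lemma pair_factor_zero [simp]: "pair_factor 0 i j = (1 :: 'a::comm_ring_1 grassmann)"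
  by (simp add: pair_factor_def)

lemma pair_factor_diag [simp]: "pair_factor c i i = (1 :: 'a::comm_ring_1 grassmann)"
  by (simp add: pair_factor_def \<xi>_square)

lemma pair_factor_swap: "pair_factor c j i = (pair_factor (- c) i j :: 'a::comm_ring_1 grassmann)"
  unfolding pair_factor_def \<xi>_anticommute[of j i] by simp

lemma mult_of_int_left_commute: "u * (of_int c * v) = of_int c * (u * v :: 'a::ring_1)"
  by (simp only: mult.assoc[symmetric] mult_of_int_commute[of c u])

lemma mult_of_int_mult_of_int:
  "of_int c * u * (of_int d * v) = of_int (c * d) * (u * v :: 'a::ring_1)"
  unfolding mult.assoc mult_of_int_left_commute[of u] by (simp add: mult.assoc)

lemma pair_factor_commute: 
  "pair_factor c i j * pair_factor d k l = (pair_factor d k l * pair_factor c i j :: 'a::comm_ring_1 grassmann)"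
proof -
  have "of_int c * u * (of_int d * v) = of_int d * v * (of_int c * u)"
    if "u * v = v * u" for u v :: "'a grassmann"
    unfolding mult_of_int_mult_of_int that mult.commute[of c d] ..
  from this[OF \<xi>_pair_commute[of i j k l]]
  have *: "of_int c * (\<xi> i * \<xi> j) * (of_int d * (\<xi> k * \<xi> l)) =
    of_int d * (\<xi> k * \<xi> l) * (of_int c * (\<xi> i * \<xi> j) :: 'a grassmann)" .
  have "(1 + u) * (1 + v) = 1 + (u + v) + u * v" for u v :: "'a grassmann"
    by (simp add: distrib_left distrib_right add.assoc)
  then show ?thesis unfolding pair_factor_def by (metis * add.commute)
qed

lemma pair_factor_add: 
  "pair_factor (c + d) i j = (pair_factor c i j * pair_factor d i j :: 'a::comm_ring_1 grassmann)"
proof -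
  have "of_int c * u * (of_int d * u) = 0" if "u * u = 0" for u :: "'a grassmann"
    unfolding mult_of_int_mult_of_int that by simp
  from this[OF \<xi>_pair_square[of i j]]
  have *: "of_int c * (\<xi> i * \<xi> j) * (of_int d * (\<xi> i * \<xi> j)) = (0 :: 'a grassmann)" .
  have "(1 + u) * (1 + v) = 1 + (u + v) + u * v" for u v :: "'a grassmann"
    by (simp add: distrib_left distrib_right add.assoc)
  from this[of "of_int c * (\<xi> i * \<xi> j)" "of_int d * (\<xi> i * \<xi> j)"] show ?thesis
    unfolding pair_factor_def * by (simp add: distrib_right)
qed

lemma power_pair_factor: "(1 + \<xi> i * \<xi> j) ^ p = (pair_factor (int p) i j :: 'a::comm_ring_1 grassmann)"
proof (induction p)
  case (Suc p)
  have "1 + \<xi> i * \<xi> j = (pair_factor 1 i j :: 'a grassmann)" by (simp add: pair_factor_def)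
  then have "(1 + \<xi> i * \<xi> j) ^ Suc p = (pair_factor (1 + int p) i j :: 'a grassmann)"
    unfolding power_Suc Suc pair_factor_add by (rule arg_cong)
  then show ?case by simp
qed simp

lemma prod_list_map_mult:
  fixes f g :: "'b \<Rightarrow> 'a::monoid_mult"
  assumes "\<And>a b. f a * g b = g b * f a"
  shows "prod_list (map (\<lambda>a. f a * g a) xs) = prod_list (map f xs) * prod_list (map g xs)"
proof (induction xs)
  case (Cons a xs)
  have "g a * prod_list (map f xs) = prod_list (map f xs) * g a"
    by (induction xs) (simp_all, metis assms mult.assoc)
  then show ?case by (simp add: Cons mult.assoc) (metis mult.assoc)
qed simp

lemma prod_list_map_single:
  fixes u :: "'a::monoid_mult"
  assumes "distinct xs" "a \<in> set xs"
  shows "prod_list (map (\<lambda>b. if b = a then u else 1) xs) = u"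
proof -
  have one: "prod_list (map (\<lambda>b. if b = a then u else 1) ys) = 1" if "a \<notin> set ys" for ys
    using that by (induction ys) auto
  show ?thesis using assms by (induction xs) (auto simp: one)
qed

text \<open>Integer exponents turn this into a homomorphism from the additive group of matrices.
  Both orders of each pair occur, and diagonal factors are 1.\<close>

definition pair_prod :: "nat \<Rightarrow> (nat \<Rightarrow> nat \<Rightarrow> int) \<Rightarrow> 'a::comm_ring_1 grassmann" where
  "pair_prod m M = prod_list (map (\<lambda>(i, j). pair_factor (M i j) i j) (List.product [0..<m] [0..<m]))"

lemma pair_prod_cong:
  assumes "\<And>i j. i < m \<Longrightarrow> j < m \<Longrightarrow> M i j = M' i j"
  shows "pair_prod m M = (pair_prod m M' :: 'a::comm_ring_1 grassmann)"
  unfolding pair_prod_def using assms by (intro arg_cong[where f = prod_list] map_cong) auto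

lemma pair_prod_add: 
  "pair_prod m (\<lambda>i j. M i j + M' i j) = (pair_prod m M * pair_prod m M' :: 'a::comm_ring_1 grassmann)"
proof -
  have "(pair_prod m M * pair_prod m M' :: 'a grassmann) = prod_list (map (\<lambda>a. (case a of (i, j) \<Rightarrow> pair_factor (M i j) i j)
      * (case a of (i, j) \<Rightarrow> pair_factor (M' i j) i j)) (List.product [0..<m] [0..<m]))"
    unfolding pair_prod_def
    by (rule prod_list_map_mult[symmetric]) (auto simp: pair_factor_commute split: prod.splits)
  also have "\<dots> = pair_prod m (\<lambda>i j. M i j + M' i j)"
    unfolding pair_prod_def
    by (rule arg_cong[where f = prod_list]) (auto simp: pair_factor_add)
  finally show ?thesis by simp
qed

lemma pair_prod_zero [simp]: "pair_prod m (\<lambda>_ _. 0) = (1 :: 'a::comm_ring_1 grassmann)"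
proof -
  have "prod_list (map (\<lambda>(i, j). pair_factor 0 i j) xs) = (1 :: 'a grassmann)" for xs
    by (induction xs) auto
  then show ?thesis by (simp add: pair_prod_def)
qed

lemma pair_prod_scale: "pair_prod m (\<lambda>i j. int c * M i j) = (pair_prod m M ^ c :: 'a::comm_ring_1 grassmann)"
proof (induction c)
  case (Suc c)
  have "pair_prod m (\<lambda>i j. int (Suc c) * M i j) =
    (pair_prod m (\<lambda>i j. M i j + int c * M i j) :: 'a grassmann)"
    by (rule pair_prod_cong) (simp add: algebra_simps)
  also have "\<dots> = pair_prod m M ^ Suc c" by (simp only: pair_prod_add Suc power_Suc)
  finally show ?case .
qed simp

lemma pair_prod_single:
  assumes "p < m" "q < m"
  shows "pair_prod m (\<lambda>i j. if i = p \<and> j = q then c else 0) =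
    (pair_factor c p q :: 'a::comm_ring_1 grassmann)"
proof -
  have "map (\<lambda>(i, j). pair_factor (if i = p \<and> j = q then c else 0) i j) (List.product [0..<m] [0..<m])
    = map (\<lambda>b. if b = (p, q) then pair_factor c p q else (1 :: 'a grassmann)) (List.product [0..<m] [0..<m])"
  proof (rule map_cong[OF refl])
    fix b :: "nat \<times> nat"
    show "(case b of (i, j) \<Rightarrow> pair_factor (if i = p \<and> j = q then c else 0) i j) =
      (if b = (p, q) then pair_factor c p q else (1 :: 'a grassmann))"
      by (cases b; cases "b = (p, q)") auto
  qed
  then show ?thesis
    unfolding pair_prod_def by (simp only:) (rule prod_list_map_single, use assms in \<open>auto simp: distinct_product\<close>)
qed

text \<open>The factors for \<open>(i, j)\<close> and \<open>(j, i)\<close> are inverse to each other, hence opposite 2-paths cancel.\<close>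

lemma pair_prod_symmetric:
  assumes sym: "\<And>i j. M i j = M j i"
  shows "pair_prod m M = (1 :: 'a::comm_ring_1 grassmann)"
proof -
  \<comment> \<open>The matrix is built up from 0 by adding index pairs. Each pair enters together
    with its opposite, so that every intermediate matrix stays symmetric.\<close>
  define r where "r A i j = (if (i, j) \<in> A \<or> (j, i) \<in> A then M i j else 0)" for A i j
  have "pair_prod m (r A) = (1 :: 'a grassmann)" if "finite A" "A \<subseteq> {..<m} \<times> {..<m}" for A
    using that
  proof (induction A rule: finite_induct)
    case empty
    then show ?case by (simp add: r_def)
  next
    case (insert a A)
    obtain p q where a: "a = (p, q)" by (cases a)
    have pq: "p < m" "q < m" using insert.prems a by auto
    have IH: "pair_prod m (r A) = (1 :: 'a grassmann)" using insert by simp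
    show ?case
    \<comment> \<open>If the opposite pair is already present nothing changes, and on the diagonal
      the new factor is 1.\<close>
    proof (cases "(q, p) \<in> A \<or> p = q")
      case True
      show ?thesis
      proof (cases "p = q")
        case True
        have "r (insert a A) i j = r A i j + (if i = p \<and> j = p then M p p else 0)" for i j
          using insert.hyps True by (auto simp: r_def a)
        then have "r (insert a A) = (\<lambda>i j. r A i j + (if i = p \<and> j = p then M p p else 0))"
          by blast
        then show ?thesis using pq by (simp add: pair_prod_add pair_prod_single IH)
      next
        case False
        then have "r (insert a A) = r A" using True by (intro ext) (auto simp: r_def a)
        then show ?thesis by (simp add: IH)
      qed
    next
      case False
      have "r (insert a A) i j = r A i j + ((if i = p \<and> j = q then M p q else 0)
          + (if i = q \<and> j = p then M p q else 0))" for i j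
        using insert.hyps False sym[of p q] by (auto simp: r_def a)
      then have "r (insert a A) = (\<lambda>i j. r A i j + ((if i = p \<and> j = q then M p q else 0)
          + (if i = q \<and> j = p then M p q else 0)))" by blast
      then have "pair_prod m (r (insert a A)) = pair_factor (M p q) p q * (pair_factor (M p q) q p :: 'a grassmann)"
        using pq by (simp add: pair_prod_add pair_prod_single IH)
      then show ?thesis
        unfolding pair_factor_swap[of "M p q" q p] pair_factor_add[symmetric] by simp
    qed
  qed
  from this[of "{..<m} \<times> {..<m}"] have "pair_prod m (r ({..<m} \<times> {..<m})) = (1 :: 'a grassmann)"
    by simp
  moreover have "pair_prod m M = (pair_prod m (r ({..<m} \<times> {..<m})) :: 'a grassmann)"
    by (rule pair_prod_cong) (simp add: r_def)
  ultimately show ?thesis by simp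
qed

text \<open>Truncated subtraction removes the symmetric matrix of minima, whose product is 1.
  Cancelling opposite 2-paths thus preserves the odd factor.\<close>

lemma pair_prod_truncated_diff:
  "pair_prod m (\<lambda>i j. int (q i j - q j i)) = (pair_prod m (\<lambda>i j. int (q i j)) :: 'a::comm_ring_1 grassmann)"
proof -
  have "(\<lambda>i j. int (q i j)) = (\<lambda>i j. int (q i j - q j i) + int (min (q i j) (q j i)))"
    by (intro ext) linarith
  then have "(pair_prod m (\<lambda>i j. int (q i j)) :: 'a grassmann) =
    pair_prod m (\<lambda>i j. int (q i j - q j i) + int (min (q i j) (q j i)))"
    by simp
  also have "\<dots> = pair_prod m (\<lambda>i j. int (q i j - q j i))"
    by (simp only: pair_prod_add) (simp add: pair_prod_symmetric min.commute)
  finally show ?thesis by simp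
qed

lemma pair_prod_transpose: "pair_prod m (\<lambda>i j. M j i) * pair_prod m M = (1 :: 'a::comm_ring_1 grassmann)"
  unfolding pair_prod_add[symmetric] by (rule pair_prod_symmetric) simp

section \<open>The body of a Grassmann element and cancellation\<close>

lemma gcoeff_add: "gcoeff (u + v :: 'a::comm_ring_1 grassmann) S = gcoeff u S + gcoeff v S"
  by transfer simp

lemma gcoeff_one_empty: "gcoeff (1 :: 'a::comm_ring_1 grassmann) {} = 1"
  by transfer simp

lemma gcoeff_mult_empty: "gcoeff (u * v :: 'a::comm_ring_1 grassmann) {} = gcoeff u {} * gcoeff v {}"
  unfolding times_grassmann.rep_eq gtimes_def by simp

lemma gcoeff_minus: "gcoeff (u - v :: 'a::comm_ring_1 grassmann) S = gcoeff u S - gcoeff v S"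
  by transfer simp

lemma gcoeff_of_int_empty: "gcoeff (of_int c :: 'a::comm_ring_1 grassmann) {} = of_int c"
proof -
  have "gcoeff (of_nat n :: 'a grassmann) {} = of_nat n" for n
    by (induction n) (simp_all add: gcoeff_add gcoeff_one_empty zero_grassmann.rep_eq)
  then show ?thesis by (cases c rule: int_diff_cases) (simp add: gcoeff_minus)
qed

lemma gcoeff_pair_factor_empty: "gcoeff (pair_factor c i j :: 'a::comm_ring_1 grassmann) {} = 1"
  by (simp add: pair_factor_def gcoeff_add gcoeff_one_empty gcoeff_mult_empty \<xi>.rep_eq)

lemma gcoeff_pair_prod_empty: "gcoeff (pair_prod m M :: 'a::comm_ring_1 grassmann) {} = 1"
proof -
  have "gcoeff (prod_list (map (\<lambda>(i, j). pair_factor (M i j) i j) xs) :: 'a grassmann) {} = 1" for xs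
    by (induction xs) (auto simp: gcoeff_one_empty gcoeff_mult_empty gcoeff_pair_factor_empty)
  then show ?thesis by (simp add: pair_prod_def)
qed

text \<open>The coefficient of \<open>u * d\<close> at \<open>S\<close> is the body of
  \<open>u\<close> times the coefficient of \<open>d\<close> at \<open>S\<close>, plus terms with
  coefficients of \<open>d\<close> at proper subsets. Induction over finite sets makes
  \<open>d\<close> vanish. This gives uniqueness of the new variable in a mutation.\<close>

lemma grassmann_left_cancel:
  fixes u v w :: "'a::field grassmann"
  assumes "gcoeff u {} \<noteq> 0" "u * v = u * w"
  shows "v = w"
proof -
  define d where "d = v - w"
  have ud: "u * d = 0" using assms(2) by (simp add: d_def right_diff_distrib)
  have "gcoeff d S = 0" for S
  proof (cases "finite S")
    case True
    then show ?thesis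
    proof (induction S rule: finite_psubset_induct)
      case (psubset S)
      have "0 = gcoeff (u * d) S" by (simp add: ud zero_grassmann.rep_eq)
      also have "\<dots> = (\<Sum>T\<in>Pow S. shuffle_sign T (S - T) * gcoeff u T * gcoeff d (S - T))"
        by (simp add: times_grassmann.rep_eq gtimes_def)
      also have "\<dots> = (\<Sum>T\<in>Pow S. if T = {} then gcoeff u {} * gcoeff d S else 0)"
      proof (rule sum.cong[OF refl])
        fix T assume "T \<in> Pow S"
        then have "gcoeff d (S - T) = 0" if "T \<noteq> {}" using that by (intro psubset.IH) auto
        then show "shuffle_sign T (S - T) * gcoeff u T * gcoeff d (S - T) =
          (if T = {} then gcoeff u {} * gcoeff d S else 0)" by simp
      qed
      also have "\<dots> = gcoeff u {} * gcoeff d S" using psubset.hyps by simp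
      finally show ?case using assms(1) by simp
    qed
  next
    case False
    then show ?thesis using gcoeff[of d] by blast
  qed
  then have "d = 0" by (simp add: gcoeff_inject[symmetric] fun_eq_iff zero_grassmann.rep_eq)
  then show ?thesis by (simp add: d_def)
qed

section \<open>Positive rational functions and elements of \<open>super_laurent\<close>\<close>

definition ratfun_pos :: "ratfun set" where
  "ratfun_pos = pos_quot (monoid_ring_eval.ev (\<lambda>c. c) (\<lambda>_. 1))"

lemma ratfun_pos: "subtraction_free ratfun_pos" "X i \<in> ratfun_pos"
proof -
  interpret monoid_ring_eval "\<lambda>c::complex. c" "\<lambda>_::nat \<Rightarrow>\<^sub>0 nat. 1"
    by standard (simp_all add: mult.commute)
  show "subtraction_free ratfun_pos"
    unfolding ratfun_pos_def by (rule pos_quot_subtraction_free) (simp_all add: ev_add ev_mult)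
  have "\<exists>r>0. ev (msingle (msingle i 1) 1) = complex_of_real r" "\<exists>r>0. ev 1 = complex_of_real r"
    by (intro exI[of _ 1], simp add: ev_single)+
  then show "X i \<in> ratfun_pos" unfolding ratfun_pos_def pos_quot_def X_def by blast
qed

lemma X_nonzero: "X i \<noteq> 0"
  using ratfun_pos(2)[of i] subtraction_freeD(1)[OF ratfun_pos(1)] by auto

lemma super_laurent_of_int: "of_int c \<in> super_laurent n m"
  and super_laurent_one: "1 \<in> super_laurent n m"
proof -
  have cst: "cst 1 = 1" "cst (- 1) = - 1" "cst 0 = 0"
    by (simp_all add: cst_def One_fract_def Zero_fract_def single_uminus)
  have gm: "gconst (- 1) = (- 1 :: ratfun grassmann)"
    by (simp add: gcoeff_inject[symmetric] fun_eq_iff gconst.rep_eq uminus_grassmann.rep_eq one_grassmann.rep_eq)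
  show one: "1 \<in> super_laurent n m"
    using super_laurent.const[of 1 n m] by (simp add: cst)
  have zero: "0 \<in> super_laurent n m"
    using super_laurent.const[of 0 n m] by (simp add: cst)
  have nat: "of_nat i \<in> super_laurent n m" for i
    by (induction i) (auto intro: zero one super_laurent.add)
  have minus: "- 1 \<in> super_laurent n m"
    using super_laurent.const[of "- 1" n m] by (simp add: cst gm)
  have "of_nat i + (- 1) * of_nat j \<in> super_laurent n m" for i j
    by (intro super_laurent.add super_laurent.mult nat minus)
  then show "of_int c \<in> super_laurent n m"
    by (cases c rule: int_diff_cases) simp
qed

lemma super_laurent_pair_prod: "pair_prod m M \<in> super_laurent n m"
proof -
  have "prod_list (map (\<lambda>(i, j). pair_factor (M i j) i j) xs) \<in> super_laurent n m"
    if "set xs \<subseteq> {..<m} \<times> {..<m}" for xs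
    using that
    by (induction xs) (auto simp: pair_factor_def
        intro!: super_laurent_one super_laurent_of_int super_laurent.intros)
  then show ?thesis unfolding pair_prod_def by force
qed

lemma super_laurent_monomial: "gconst (\<Prod>i<n. X i powi e i) \<in> super_laurent n m"
proof -
  have pow: "gconst (a ^ p) \<in> super_laurent n m" if "gconst a \<in> super_laurent n m" for a p
    using that by (induction p) (auto simp: gconst_mult intro: super_laurent.mult super_laurent_one)
  have "gconst (X i powi e i) \<in> super_laurent n m" if "i < n" for i
    using pow super_laurent.even[OF that] super_laurent.even_inverse[OF that]
    by (auto simp: power_int_def)
  then have "gconst (\<Prod>i\<in>B. X i powi e i) \<in> super_laurent n m" if "B \<subseteq> {..<n}" for B
    using that by (induction B rule: infinite_finite_induct)
      (auto simp: gconst_mult intro: super_laurent.mult super_laurent_one)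
  then show ?thesis by simp
qed


section \<open>Extended quivers as regauged framed quivers\<close>

lemma monomial_power: "msingle a (1::int) ^ i = msingle (frag_cmul (int i) a) 1"
  for a :: "nat \<Rightarrow>\<^sub>0 int"
  by (induction i) (simp_all add: mult_single frag_cmul_distrib)

lemma monomial_prod: "finite B \<Longrightarrow> (\<Prod>l\<in>B. msingle (a l) (1::int)) = msingle (\<Sum>l\<in>B. a l) 1"
  for a :: "nat \<Rightarrow> nat \<Rightarrow>\<^sub>0 int"
  by (induction B rule: finite_induct) (simp_all add: mult_single)

lemma (in monoid_ring_eval) prod_list_ev: "prod_list (map (\<lambda>l. ev (g l)) [0..<n]) = ev (\<Prod>l<n. g l)"
  by (induction n) (simp_all add: ev_mult)

text \<open>Arrow counts are the positive parts of skew-symmetric entries, and truncated subtraction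
  again takes a positive part. Indices stay below \<open>n\<close> because the matrix used later
  also has frozen vertices.\<close>

lemma mutate_arrows_eq:
  assumes b: "skew b" and a: "\<And>i j. i < n \<Longrightarrow> j < n \<Longrightarrow> a i j = nat (b i j)"
    and ij: "i < n" "j < n" "k < n"
  shows "mutate_arrows k a i j = nat (mut_mat k b i j)"
proof -
  have bb: "b j i = - b i j" "b k i = - b i k" "b k j = - b j k" "b k k = 0"
    using skewD[OF b] skew_diag[OF b] by blast+
  have aa: "a i j = nat (b i j)" "a j i = nat (- b i j)" "a i k = nat (b i k)" "a k i = nat (- b i k)"
    "a k j = nat (- b j k)" "a j k = nat (b j k)" "a k k = 0"
    using a ij bb by simp_all
  show ?thesis
  proof (cases "i = k \<or> j = k")
    case True
    then have "mutate_arrows k a i j = a j i - a i j"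
      using aa(7) by (auto simp: mutate_arrows_def Let_def)
    moreover have "mut_mat k b i j = - b i j" using True by (simp add: mut_mat_def)
    ultimately show ?thesis using aa(1,2) by linarith
  next
    case False
    define s where "s = nat (b i k) * nat (- b j k)"
    define t where "t = nat (b j k) * nat (- b i k)"
    have "mutate_arrows k a i j = (nat (b i j) + s) - (nat (- b i j) + t)"
      using False by (simp add: mutate_arrows_def Let_def aa s_def t_def)
    moreover have "mut_mat k b i j = b i j + int s - int t"
      using False by (simp add: mut_mat_def bb s_def t_def)
    ultimately show ?thesis by linarith
  qed
qed

text \<open>The sums transform like 2-paths under mutation: negated at \<open>k\<close>, and
  increased at \<open>l\<close> by the value at \<open>k\<close> times the number of arrows from
  \<open>k\<close> to \<open>l\<close>. Rewriting each negative part as positive part minus entry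
  makes the mutation rule linear; the terms with \<open>b k l\<close> then cancel against the
  updated value at \<open>k\<close>.\<close>

lemma sum_update_mut_mat:
  fixes \<gamma> :: "nat \<Rightarrow> int"
  assumes b: "skew b" and kl: "k < N"
  defines "\<gamma>' \<equiv> \<gamma>(k := (\<Sum>i<N. max 0 (b k i) * \<gamma> i) - \<gamma> k)"
  shows "(\<Sum>i<N. mut_mat k b l i * \<gamma>' i) = (if l = k then - (\<Sum>i<N. b k i * \<gamma> i)
    else (\<Sum>i<N. b l i * \<gamma> i) + max 0 (b k l) * (\<Sum>i<N. b k i * \<gamma> i))"
proof -
  define A where "A = {..<N} - {k}"
  have split: "(\<Sum>i<N. g i) = g k + (\<Sum>i\<in>A. g i)" for g :: "nat \<Rightarrow> int"
    unfolding A_def by (rule sum.remove) (use kl in auto)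
  have bkk: "b k k = 0" by (rule skew_diag[OF b])
  have blk: "b l k = - b k l" by (rule skewD[OF b])
  have \<gamma>A: "\<gamma>' i = \<gamma> i" if "i \<in> A" for i using that by (simp add: \<gamma>'_def A_def)
  have \<gamma>k: "\<gamma>' k = (\<Sum>i\<in>A. max 0 (b k i) * \<gamma> i) - \<gamma> k"
    by (simp add: \<gamma>'_def split bkk)
  show ?thesis
  proof (cases "l = k")
    case True
    have "(\<Sum>i\<in>A. mut_mat k b l i * \<gamma>' i) = (\<Sum>i\<in>A. - (b k i * \<gamma> i))"
      by (rule sum.cong) (simp_all add: True mut_mat_def \<gamma>A)
    then show ?thesis by (simp add: split True mut_mat_def bkk sum_negf)
  next
    case False
    have "mut_mat k b l i * \<gamma>' i =
        b l i * \<gamma> i + max 0 (b k l) * (b k i * \<gamma> i) - b k l * (max 0 (b k i) * \<gamma> i)" if "i \<in> A" for i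
    proof -
      have "mut_mat k b l i = b l i + max 0 (- b k l) * max 0 (b k i) - max 0 (b k l) * max 0 (- b k i)"
        using that False by (simp add: mut_mat_def A_def blk)
      moreover have "max 0 (- b k l) = max 0 (b k l) - b k l" "max 0 (- b k i) = max 0 (b k i) - b k i"
        by auto
      ultimately have "mut_mat k b l i = b l i + max 0 (b k l) * b k i - b k l * max 0 (b k i)"
        by (simp only:) (simp add: algebra_simps)
      then show ?thesis unfolding \<gamma>A[OF that] by (simp only: distrib_right left_diff_distrib mult.assoc)
    qed
    then have "(\<Sum>i\<in>A. mut_mat k b l i * \<gamma>' i) = (\<Sum>i\<in>A. b l i * \<gamma> i)
        + max 0 (b k l) * (\<Sum>i\<in>A. b k i * \<gamma> i) - b k l * (\<Sum>i\<in>A. max 0 (b k i) * \<gamma> i)"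
      by (simp add: sum.distrib sum_subtractf sum_distrib_left)
    moreover have "mut_mat k b l k * \<gamma>' k = b k l * (\<Sum>i\<in>A. max 0 (b k i) * \<gamma> i) - b k l * \<gamma> k"
      by (simp add: mut_mat_def blk \<gamma>k algebra_simps)
    ultimately show ?thesis using False by (simp add: split blk bkk)
  qed
qed

section \<open>The framed quiver and the gauge monomials\<close>

locale framed_quiver =
  fixes n m :: nat and Q :: ext_quiver
  assumes quiver: "extended_quiver n m Q"
begin

text \<open>
  The frozen variable \<open>n + i\<close> stands for the product of the factors \<open>1 + \<xi> p * \<xi> q\<close> over the
  2-paths through the vertex \<open>i\<close> of the initial quiver.
\<close>

definition weight :: "(nat \<Rightarrow>\<^sub>0 int) \<Rightarrow> nat \<Rightarrow> nat \<Rightarrow> int" where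
  "weight a p q = (\<Sum>i<n. mlookup a (n + i) * int (paths Q i p q))"

text \<open>Mutable variables go to the \<open>X i\<close>, frozen ones to products of odd factors,
  and variables with index from \<open>2 * n\<close> on to 1.\<close>

definition \<phi> :: "(nat \<Rightarrow>\<^sub>0 int) \<Rightarrow> ratfun grassmann" where
  "\<phi> a = gconst (\<Prod>i<n. X i powi mlookup a i) * pair_prod m (weight a)"

sublocale monoid_ring_eval "of_int :: int \<Rightarrow> ratfun grassmann" \<phi>
proof
  show "\<phi> 0 = 1" by (simp add: \<phi>_def weight_def[abs_def])
  fix a b
  have w: "weight (a + b) = (\<lambda>p q. weight a p q + weight b p q)"
    by (intro ext) (simp add: weight_def lookup_add distrib_right sum.distrib)
  have "(\<Prod>i<n. X i powi mlookup (a + b) i) = (\<Prod>i<n. X i powi mlookup a i) * (\<Prod>i<n. X i powi mlookup b i)"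
    by (simp add: lookup_add power_int_add X_nonzero prod.distrib)
  then have "\<phi> (a + b) = gconst (\<Prod>i<n. X i powi mlookup a i) * (gconst (\<Prod>i<n. X i powi mlookup b i)
      * pair_prod m (weight a)) * pair_prod m (weight b)"
    by (simp only: \<phi>_def w pair_prod_add gconst_mult mult.assoc)
  also have "\<dots> = \<phi> a * \<phi> b"
    unfolding gconst_central[of _ "pair_prod m (weight a)"] by (simp only: \<phi>_def mult.assoc)
  finally show "\<phi> (a + b) = \<phi> a * \<phi> b" .
qed (simp_all, rule mult_of_int_commute)

lemma ev_super_laurent: "ev p \<in> super_laurent n m"
  by (rule ev_closed) (auto simp: \<phi>_def intro: super_laurent_of_int super_laurent.add
      super_laurent.mult super_laurent_monomial super_laurent_pair_prod)

definition x0 :: "nat \<Rightarrow> ratfun" where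
  "x0 i = (if i < n then X i else 1)"

lemma x0_pos: "x0 i \<in> ratfun_pos"
  using ratfun_pos subtraction_freeD(2)[OF ratfun_pos(1)] by (simp add: x0_def)

lemma x0_nonzero: "x0 i \<noteq> 0"
  by (simp add: x0_def X_nonzero)

text \<open>Taking the body is multiplicative and turns odd factors into 1, which is why
  \<open>x0\<close> is 1 on frozen indices. Nonvanishing of a body thus becomes a subtraction-free
  statement about rational functions.\<close>

lemma gcoeff_ev_empty: "gcoeff (ev p) {} = laurent_eval x0 p"
proof -
  interpret body: monoid_ring_eval "of_int :: int \<Rightarrow> ratfun" "monomial_value x0"
    by (rule monoid_ring_eval_field) (rule x0_nonzero)
  have "gcoeff (\<phi> a) {} = monomial_value x0 a" for a
  proof -
    have "monomial_value x0 a = (\<Prod>i\<in>{..<n} \<union> mkeys a. x0 i powi mlookup a i)"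
      by (rule monomial_value_superset) auto
    also have "\<dots> = (\<Prod>i<n. x0 i powi mlookup a i)"
      by (rule prod.mono_neutral_right) (auto simp: x0_def)
    also have "\<dots> = (\<Prod>i<n. X i powi mlookup a i)" by (simp add: x0_def)
    finally show ?thesis
      by (simp add: \<phi>_def gcoeff_mult_empty gcoeff_pair_prod_empty gconst.rep_eq)
  qed
  moreover have "gcoeff (\<Sum>a\<in>B. of_int (mlookup p a) * \<phi> a) {} =
    (\<Sum>a\<in>B. of_int (mlookup p a) * gcoeff (\<phi> a) {})" for B
    by (induction B rule: infinite_finite_induct)
      (simp_all add: gcoeff_add gcoeff_mult_empty gcoeff_of_int_empty zero_grassmann.rep_eq)
  ultimately show ?thesis
    by (simp add: ev_def laurent_eval_def body.ev_def)
qed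

text \<open>Each frozen vertex has a single arrow, into its mutable partner. Its variable therefore
  enters the incoming monomial, the one that carries the odd factor in the exchange
  relation.\<close>

definition framed :: "nat \<Rightarrow> nat \<Rightarrow> int" where
  "framed i j = (if i < n \<and> j < n then int (arrows Q i j) - int (arrows Q j i)
     else if j < n \<and> i = n + j then 1 else if i < n \<and> j = n + i then - 1 else 0)"

lemma skew_framed: "skew framed"
  by (auto simp: skew_def framed_def)

abbreviation mat_after :: "nat list \<Rightarrow> nat \<Rightarrow> nat \<Rightarrow> int" where
  "mat_after ks \<equiv> fold mut_mat ks framed"

abbreviation poly_after :: "nat list \<Rightarrow> nat \<Rightarrow> laurent" where
  "poly_after ks \<equiv> lpoly (2 * n) framed ks"

text \<open>The gauge exponent of the outgoing monomial at \<open>k\<close> minus that of the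
  incoming one; the odd factor has to compensate for it.\<close>

definition path_exponent :: "nat list \<Rightarrow> (nat \<Rightarrow> nat \<Rightarrow>\<^sub>0 int) \<Rightarrow> nat \<Rightarrow> nat \<Rightarrow>\<^sub>0 int" where
  "path_exponent ks c k = (\<Sum>l<2 * n. frag_cmul (mat_after ks k l) (c l))"

text \<open>
  The even variables differ from the cluster variables of the framed quiver by monomials
  \<open>c i\<close> in the frozen variables. Extending the gauge by the inverse of each frozen variable turns
  every frozen variable into 1 and its arrows into the coefficients \<open>path_exponent\<close>.
\<close>

definition gauged :: "nat list \<Rightarrow> (nat \<Rightarrow> nat \<Rightarrow>\<^sub>0 int) \<Rightarrow> ext_quiver \<times> (nat \<Rightarrow> ratfun grassmann) \<Rightarrow> bool" where
  "gauged ks c = (\<lambda>(R, x).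
    (\<forall>i<n. \<forall>j<n. arrows R i j = nat (mat_after ks i j)) \<and>
    (\<forall>i<n. x i = ev (msingle (c i) 1 * poly_after ks i)) \<and>
    (\<forall>i<n. c (n + i) = - msingle (n + i) 1) \<and>
    (\<forall>k<n. pair_prod m (\<lambda>i j. int (paths R k i j)) = ev (msingle (path_exponent ks c k) 1)))"

lemma laurent_prefix: "set ks \<subseteq> {..<n} \<Longrightarrow> laurent_at (2 * n) framed ks"
  by (rule laurent_phenomenon[OF skew_framed]) auto

lemma poly_after_frozen: "set ks \<subseteq> {..<n} \<Longrightarrow> poly_after ks (n + i) = var (n + i)"
proof (induction ks rule: rev_induct)
  case Nil
  show ?case by (rule lpoly_Nil)
next
  case (snoc k ks)
  then show ?case
    using lpoly_snoc(2)[OF laurent_prefix laurent_prefix, of ks k "n + i"] by simp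
qed

lemma gauged_initial:
  "gauged [] (\<lambda>i. if i < n then 0 else - msingle i 1) (initial_seed Q)"
  unfolding gauged_def initial_seed_def
proof (clarsimp, intro conjI allI impI)
  fix i j assume ij: "i < n" "j < n"
  have "\<not> (arrows Q i j > 0 \<and> arrows Q j i > 0)"
    using quiver by (simp add: extended_quiver_def)
  then show "arrows Q i j = nat (framed i j)" using ij by (auto simp: framed_def)
next
  fix i assume i: "i < n"
  have "weight (msingle i 1) = (\<lambda>_ _. 0)"
    by (intro ext) (use i in \<open>simp add: weight_def lookup_single when_def\<close>)
  moreover have "(\<Prod>l<n. X l powi mlookup (msingle i 1) l) = (\<Prod>l<n. if l = i then X l else 1)"
    by (rule prod.cong) (auto simp: lookup_single when_def)
  ultimately show "gconst (X i) = ev (poly_after [] i)"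
    using i by (simp add: lpoly_Nil var_def ev_single \<phi>_def)
next
  let ?c = "\<lambda>i. if i < n then 0 else - msingle i (1::int)"
  fix k assume k: "k < n"
  have "path_exponent [] ?c k = (\<Sum>l<2 * n. if l = n + k then msingle (n + k) 1 else 0)"
    unfolding path_exponent_def by (rule sum.cong) (use k in \<open>auto simp: framed_def\<close>)
  also have "\<dots> = msingle (n + k) 1" using k by simp
  finally have e: "path_exponent [] ?c k = msingle (n + k) 1" .
  have "weight (msingle (n + k) 1) = (\<lambda>i j. int (paths Q k i j))"
  proof (intro ext)
    fix p q
    have "weight (msingle (n + k) 1) p q = (\<Sum>i<n. if i = k then int (paths Q i p q) else 0)"
      unfolding weight_def by (rule sum.cong) (auto simp: lookup_single when_def)
    then show "weight (msingle (n + k) 1) p q = int (paths Q k p q)" using k by simp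
  qed
  moreover have "(\<Prod>l<n. X l powi mlookup (msingle (n + k) 1) l) = 1"
    by (rule prod.neutral) (auto simp: lookup_single when_def)
  ultimately have "\<phi> (msingle (n + k) 1) = pair_prod m (\<lambda>i j. int (paths Q k i j))"
    by (simp add: \<phi>_def)
  then show "pair_prod m (\<lambda>i j. int (paths Q k i j)) = ev (msingle (path_exponent [] ?c k) 1)"
    by (simp only: e ev_single of_int_1 mult_1_left)
qed

lemma path_exponent_mut:
  fixes ks :: "nat list" and k :: nat and c :: "nat \<Rightarrow> nat \<Rightarrow>\<^sub>0 int"
  assumes "k < n"
  defines "c' \<equiv> c(k := (\<Sum>i<2 * n. frag_cmul (max 0 (mat_after ks k i)) (c i)) - c k)"
  shows "path_exponent (ks @ [k]) c' l = (if l = k then - path_exponent ks c k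
    else path_exponent ks c l + frag_cmul (max 0 (mat_after ks k l)) (path_exponent ks c k))"
proof (rule poly_mapping_eqI)
  fix q
  define \<gamma> where "\<gamma> i = mlookup (c i) q" for i
  have "(\<lambda>i. mlookup (c' i) q) = \<gamma>(k := (\<Sum>i<2 * n. max 0 (mat_after ks k i) * \<gamma> i) - \<gamma> k)"
    by (rule ext) (simp add: c'_def \<gamma>_def lookup_minus lookup_sum)
  then have "mlookup (path_exponent (ks @ [k]) c' l) q = (\<Sum>i<2 * n. mut_mat k (mat_after ks) l i *
      (\<gamma>(k := (\<Sum>i<2 * n. max 0 (mat_after ks k i) * \<gamma> i) - \<gamma> k)) i)"
    by (simp add: path_exponent_def lookup_sum fun_eq_iff)
  also have "\<dots> = (if l = k then - (\<Sum>i<2 * n. mat_after ks k i * \<gamma> i)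
    else (\<Sum>i<2 * n. mat_after ks l i * \<gamma> i) + max 0 (mat_after ks k l) * (\<Sum>i<2 * n. mat_after ks k i * \<gamma> i))"
    by (rule sum_update_mut_mat[OF skew_fold[OF skew_framed]]) (use assms(1) in simp)
  finally show "mlookup (path_exponent (ks @ [k]) c' l) q = mlookup (if l = k then - path_exponent ks c k
    else path_exponent ks c l + frag_cmul (max 0 (mat_after ks k l)) (path_exponent ks c k)) q"
    by (simp add: path_exponent_def lookup_sum lookup_add \<gamma>_def)
qed

text \<open>The outgoing monomial carries the gauge factor with exponent \<open>t\<close>, and so
  does the incoming one after multiplication by the odd factor. The right-hand side is thus a
  monomial times the framed exchange polynomial, and the new gauge at \<open>k\<close> is
  \<open>t - c k\<close>.\<close>

lemma gauged_mutate:
  assumes g: "gauged ks c s" and ks: "set ks \<subseteq> {..<n}" and k: "k < n"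
  shows "gauged (ks @ [k]) (c(k := (\<Sum>i<2 * n. frag_cmul (max 0 (mat_after ks k i)) (c i)) - c k))
    (mutate n m k s)"
proof -
  obtain R x where s: "s = (R, x)" by (cases s)
  define b where "b = mat_after ks"
  define U where "U = poly_after ks"
  define t where "t = (\<Sum>i<2 * n. frag_cmul (max 0 (b k i)) (c i))"
  have arr: "\<And>i j. i < n \<Longrightarrow> j < n \<Longrightarrow> arrows R i j = nat (b i j)"
    and x: "\<And>i. i < n \<Longrightarrow> x i = ev (msingle (c i) 1 * U i)"
    and cf: "\<And>i. i < n \<Longrightarrow> c (n + i) = - msingle (n + i) 1"
    and pth: "\<And>k. k < n \<Longrightarrow> pair_prod m (\<lambda>i j. int (paths R k i j)) = ev (msingle (path_exponent ks c k) 1)"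
    using g by (simp_all add: gauged_def s b_def U_def)
  have skb: "skew b" unfolding b_def by (rule skew_fold[OF skew_framed])
  have at: "laurent_at (2 * n) framed ks" "laurent_at (2 * n) framed (ks @ [k])"
    by (rule laurent_prefix; use ks k in simp)+
  have ser: "prod_list (map (\<lambda>l. x l ^ e l) [0..<n]) =
      ev (msingle (\<Sum>l<2 * n. frag_cmul (int (e l)) (c l)) 1 * (\<Prod>l<2 * n. U l ^ e l))" for e
  proof -
    have "prod_list (map (\<lambda>l. x l ^ e l) [0..<n]) =
        prod_list (map (\<lambda>l. ev ((msingle (c l) 1 * U l) ^ e l)) [0..<n])"
      by (intro arg_cong[where f = prod_list] map_cong) (auto simp: x ev_power)
    also have "\<dots> = ev (\<Prod>l<n. (msingle (c l) 1 * U l) ^ e l)" by (rule prod_list_ev)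
    also have "(\<Prod>l<n. (msingle (c l) 1 * U l) ^ e l) = (\<Prod>l<2 * n. (msingle (c l) 1 * U l) ^ e l)"
    proof (rule prod.mono_neutral_left)
      show "\<forall>l\<in>{..<2 * n} - {..<n}. (msingle (c l) 1 * U l) ^ e l = 1"
      proof
        fix l assume l: "l \<in> {..<2 * n} - {..<n}"
        define i where "i = l - n"
        have i: "l = n + i" "i < n" using l by (auto simp: i_def)
        have "msingle (c l) 1 * U l = 1"
          unfolding i(1) U_def poly_after_frozen[OF ks] cf[OF i(2)] by (simp add: var_def mult_single)
        then show "(msingle (c l) 1 * U l) ^ e l = 1" by simp
      qed
    qed auto
    also have "\<dots> = msingle (\<Sum>l<2 * n. frag_cmul (int (e l)) (c l)) 1 * (\<Prod>l<2 * n. U l ^ e l)"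
      by (simp add: power_mult_distrib prod.distrib monomial_power monomial_prod)
    finally show ?thesis .
  qed
  have P: "prod_list (map (\<lambda>(i, j). (1 + \<xi> i * \<xi> j) ^ paths R k i j) (List.product [0..<m] [0..<m]))
    = ev (msingle (path_exponent ks c k) 1)"
    using pth[OF k] by (simp add: power_pair_factor pair_prod_def)
  have out: "prod_list (map (\<lambda>l. x l ^ arrows R k l) [0..<n]) =
      ev (msingle t 1 * (\<Prod>l<2 * n. U l ^ nat (b k l)))"
  proof -
    have eq: "map (\<lambda>l. x l ^ arrows R k l) [0..<n] = map (\<lambda>l. x l ^ nat (b k l)) [0..<n]"
      using arr k by simp
    have "int (nat (b k l)) = max 0 (b k l)" for l by auto
    then show ?thesis unfolding eq ser by (simp only: t_def)
  qed
  have inn: "prod_list (map (\<lambda>l. x l ^ arrows R l k) [0..<n]) =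
      ev (msingle (t - path_exponent ks c k) 1 * (\<Prod>l<2 * n. U l ^ nat (- b k l)))"
  proof -
    have "arrows R l k = nat (- b k l)" if "l < n" for l
      using arr[OF that k] skewD[OF skb, of l k] by simp
    then have eq: "map (\<lambda>l. x l ^ arrows R l k) [0..<n] = map (\<lambda>l. x l ^ nat (- b k l)) [0..<n]" by simp
    have "(\<Sum>l<2 * n. frag_cmul (int (nat (- b k l))) (c l)) = t - path_exponent ks c k"
    proof -
      have "int (nat (- b k l)) = max 0 (b k l) - b k l" for l by auto
      then show ?thesis
        by (simp only: frag_cmul_diff_distrib sum_subtractf t_def path_exponent_def b_def)
    qed
    then show ?thesis unfolding eq ser by (simp only:)
  qed
  define y where "y = ev (msingle (t - c k) 1 * poly_after (ks @ [k]) k)"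
  have rhs: "exchange_rhs n m R x k = ev (msingle t 1 * exch (2 * n) b U k)"
  proof -
    have "exchange_rhs n m R x k = ev (msingle t 1 * (\<Prod>l<2 * n. U l ^ nat (b k l)) +
      msingle (path_exponent ks c k) 1 * (msingle (t - path_exponent ks c k) 1 * (\<Prod>l<2 * n. U l ^ nat (- b k l))))"
      unfolding exchange_rhs_def P out inn by (simp only: ev_add ev_mult)
    also have "msingle (path_exponent ks c k) 1 * (msingle (t - path_exponent ks c k) 1 * (\<Prod>l<2 * n. U l ^ nat (- b k l)))
      = msingle t 1 * (\<Prod>l<2 * n. U l ^ nat (- b k l))"
      by (simp add: mult_single flip: mult.assoc)
    finally show ?thesis by (simp add: exch_def distrib_left)
  qed
  have xy: "x k * y = exchange_rhs n m R x k"
  proof -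
    have "x k * y = ev (msingle (c k) 1 * U k * (msingle (t - c k) 1 * poly_after (ks @ [k]) k))"
      unfolding x[OF k] y_def by (simp only: ev_mult)
    also have "msingle (c k) 1 * U k * (msingle (t - c k) 1 * poly_after (ks @ [k]) k) =
      msingle (c k) 1 * msingle (t - c k) 1 * (U k * poly_after (ks @ [k]) k)" by (simp only: ac_simps)
    also have "\<dots> = msingle t 1 * exch (2 * n) b U k"
      unfolding U_def b_def lpoly_snoc(1)[OF at] by (simp add: mult_single)
    finally show ?thesis by (simp only: rhs)
  qed
  \<comment> \<open>A nonzero body makes the solution of the exchange relation unique, as the
    definite description requires.\<close>
  have body: "gcoeff (x k) {} \<noteq> 0"
  proof -
    have "laurent_eval x0 (U k) = snd (fold (mut_seed (2 * n)) ks (framed, x0)) k"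
      unfolding U_def
      by (rule mut_seeds_specialize[OF ratfun_pos(1) x0_pos, symmetric], rule laurent_prefix) (use ks in auto)
    also have "\<dots> \<in> ratfun_pos" by (rule fold_subtraction_free[OF ratfun_pos(1) x0_pos])
    finally have "laurent_eval x0 (U k) \<noteq> 0" using subtraction_freeD(1)[OF ratfun_pos(1)] by auto
    moreover have "laurent_eval x0 (msingle (c k) 1) \<noteq> 0"
    proof
      assume "laurent_eval x0 (msingle (c k) 1) = 0"
      then have "laurent_eval x0 (msingle (c k) 1 * msingle (- c k) 1) = 0"
        by (simp add: laurent_eval_mult[OF x0_nonzero])
      moreover have "laurent_eval x0 1 = gcoeff (ev 1) {}" by (rule gcoeff_ev_empty[symmetric])
      ultimately show False by (simp add: mult_single gcoeff_one_empty)
    qed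
    ultimately show ?thesis
      by (simp add: x[OF k] gcoeff_ev_empty laurent_eval_mult[OF x0_nonzero])
  qed
  have the: "(THE y. x k * y = exchange_rhs n m R x k) = y"
    by (rule the_equality[where P = "\<lambda>y. x k * y = exchange_rhs n m R x k", OF xy])
      (rule grassmann_left_cancel[OF body], simp add: xy)
  define c' where "c' = c(k := t - c k)"
  have pe: "path_exponent (ks @ [k]) c' l = (if l = k then - path_exponent ks c k
    else path_exponent ks c l + frag_cmul (max 0 (b k l)) (path_exponent ks c k))" for l
    unfolding c'_def t_def b_def by (rule path_exponent_mut[OF k])
  define a where "a = arrows R"
  define p where "p = paths R"
  \<comment> \<open>Without loops at \<open>k\<close>, no 2-path is added at \<open>k\<close> before
    the reversal, and reversal inverts the odd factor.\<close>
  have akk: "a k k = 0" using arr[OF k k] skew_diag[OF skb, of k] by (simp add: a_def)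
  have paths': "pair_prod m (\<lambda>i j. int (mutate_paths k a p l i j)) = ev (msingle (path_exponent (ks @ [k]) c' l) 1)"
    if l: "l < n" for l
  proof (cases "l = k")
    case True
    let ?E = "pair_prod m (\<lambda>i j. int (p k i j)) :: ratfun grassmann"
    let ?F = "ev (msingle (- path_exponent ks c k) 1)"
    have "mutate_paths k a p l = (\<lambda>i j. p k j i - p k i j)"
      by (intro ext) (simp add: mutate_paths_def Let_def True akk)
    then have "pair_prod m (\<lambda>i j. int (mutate_paths k a p l i j)) = pair_prod m (\<lambda>i j. int (p k j i))"
      by (simp only: pair_prod_truncated_diff[of m "\<lambda>i j. p k j i"])
    also have "\<dots> = pair_prod m (\<lambda>i j. int (p k j i)) * (?E * ?F)"
      unfolding p_def pth[OF k] ev_mult[symmetric] mult_single by simp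
    also have "\<dots> = ?F"
      unfolding mult.assoc[symmetric] pair_prod_transpose[of m "\<lambda>i j. int (p k i j)"] by simp
    finally show ?thesis by (simp add: pe True)
  next
    case False
    have "mutate_paths k a p l = (\<lambda>i j. (p l i j + p k i j * a k l) - (p l j i + p k j i * a k l))"
      by (intro ext) (simp add: mutate_paths_def Let_def False)
    then have "pair_prod m (\<lambda>i j. int (mutate_paths k a p l i j)) =
        pair_prod m (\<lambda>i j. int (p l i j + p k i j * a k l))"
      by (simp only: pair_prod_truncated_diff[of m "\<lambda>i j. p l i j + p k i j * a k l"])
    also have "\<dots> = pair_prod m (\<lambda>i j. int (p l i j) + int (a k l) * int (p k i j))"
      by (simp add: mult.commute)
    also have "\<dots> = ev (msingle (path_exponent ks c l) 1) * ev (msingle (path_exponent ks c k) 1) ^ a k l"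
      by (simp only: pair_prod_add pair_prod_scale p_def pth[OF l] pth[OF k])
    also have "\<dots> = ev (msingle (path_exponent ks c l + frag_cmul (int (a k l)) (path_exponent ks c k)) 1)"
      by (simp add: mult_single monomial_power flip: ev_power ev_mult)
    also have "int (a k l) = max 0 (b k l)" using arr[OF k l] by (simp add: a_def)
    finally show ?thesis by (simp add: pe False)
  qed
  have "gauged (ks @ [k]) c' (mutate n m k s)"
    unfolding gauged_def mutate_def s prod.case the mutate_quiver_def
  proof (intro conjI allI impI)
    fix i assume i: "i < n"
    show "c' (n + i) = - msingle (n + i) 1" using cf[OF i] k by (simp add: c'_def)
    show "(x(k := y)) i = ev (msingle (c' i) 1 * poly_after (ks @ [k]) i)"
      using x[OF i] lpoly_snoc(2)[OF at, of i] by (simp add: c'_def y_def U_def)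
    show "pair_prod m (\<lambda>p q. int (paths \<lparr>arrows = mutate_arrows k (arrows R),
        paths = mutate_paths k (arrows R) (paths R)\<rparr> i p q)) = ev (msingle (path_exponent (ks @ [k]) c' i) 1)"
      using paths'[OF i] by (simp add: a_def p_def)
    fix j assume j: "j < n"
    show "arrows \<lparr>arrows = mutate_arrows k (arrows R), paths = mutate_paths k (arrows R) (paths R)\<rparr> i j
      = nat (mat_after (ks @ [k]) i j)"
      using mutate_arrows_eq[OF skb arr i j k] by (simp add: b_def)
  qed
  then show ?thesis unfolding c'_def t_def b_def .
qed

lemma gauged_cluster:
  assumes "set ks \<subseteq> {..<n}"
  shows "\<exists>c. gauged ks c (fold (mutate n m) ks (initial_seed Q))"
  using assms
proof (induction ks rule: rev_induct)
  case Nil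
  then show ?case using gauged_initial by auto
next
  case (snoc k ks)
  then obtain c where "gauged ks c (fold (mutate n m) ks (initial_seed Q))" by auto
  from gauged_mutate[OF this, of k] show ?case using snoc.prems by auto
qed

lemma cluster_super_laurent:
  assumes "set ks \<subseteq> {..<n}" "l < n"
  shows "cluster n m Q ks l \<in> super_laurent n m"
proof -
  obtain c where "gauged ks c (fold (mutate n m) ks (initial_seed Q))"
    using gauged_cluster[OF assms(1)] by blast
  then have "cluster n m Q ks l = ev (msingle (c l) 1 * poly_after ks l)"
    using assms(2) by (simp add: gauged_def cluster_def split: prod.splits)
  then show ?thesis by (simp add: ev_super_laurent)
qed

end

theorem theorem3p1:
  fixes n m :: nat and Q :: ext_quiver and ks :: "nat list" and l :: nat
  assumes "extended_quiver n m Q"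
    and "set ks \<subseteq> {..<n}"
    and "l < n"
  shows "cluster n m Q ks l \<in> super_laurent n m"
proof -
  interpret framed_quiver n m Q by standard (rule assms(1))
  show ?thesis by (rule cluster_super_laurent[OF assms(2,3)])
qed

end
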